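(* Let $d \ge 2$, $k_1, k_2 \ge 1$ be integers, and let $R_1,R_2$ be non-empty families of partitions of $[d]$. There exists an integer $C_{d,R_1,R_2}(k_1, k_2)$, depending only on $d,R_1,R_2,k_1,k_2$, such that for every field $\mathbb{F}$ and all positive integers $n_1,\dots,n_d$, if $T:[n_1]\times\dots\times[n_d]\to\mathbb{F}$ is an order-$d$ tensor with $R_1$-rank at most $k_1$ and $R_2$-rank at most $k_2$, then the $(R_1\wedge R_2)$-rank of $T$ is at most $C_{d,R_1,R_2}(k_1, k_2)$.
   Context: $[d]=\{1,\dots,d\}$; the parts of a partition are non-empty. $\mathbb{F}$ is an arbitrary field. For positive integers $n_1,\dots,n_d$, an order-$d$ tensor is a function $T:[n_1]\times\dots\times[n_d]\to\mathbb{F}$. For $x\in[n_1]\times\dots\times[n_d]$ and $J\subset[d]$, $x(J)\in\prod_{j\in J}[n_j]$ denotes the restriction of $x$ to its coordinates in $J$. $R$-rank: let $R$ be a non-empty family of partitions of $[d]$. An order-$d$ tensor $T$ has $R$-rank at most $1$ if there exist a partition $P\in R$ and, for each $J\in P$, a function $a_J:\prod_{j\in J}[n_j]\to\mathbb{F}$ such that $T(x)=\prod_{J\in P}a_J(x(J))$ for all $x$. The $R$-rank of $T$ is the smallest nonnegative integer $k$ such that $T=T_1+\dots+T_k$ for some order-$d$ tensors $T_1,\dots,T_k$ each of $R$-rank at most $1$ (the partition used may differ from one $T_i$ to another; the zero tensor has $R$-rank $0$). Least common refinement: for partitions $P_1,P_2$ of $[d]$, $P_1\wedge P_2=\{J_1\cap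 J_2: J_1\in P_1, J_2\in P_2, J_1\cap J_2\neq\emptyset\}$. For non-empty families $R_1,R_2$ of partitions of $[d]$, $R_1\wedge R_2=\{P_1\wedge P_2: P_1\in R_1, P_2\in R_2\}$. *)

theory Defs
  imports "HOL-Algebra.Ring" "HOL-Library.FuncSet" "HOL-Library.Disjoint_Sets"
begin

text \<open>
  Fields are \<^theory>\<open>HOL-Algebra.Ring\<close> structures with explicit carrier. A multi-index with
  coordinates in \<open>J\<close> is an extensional function on \<open>J\<close>, so that the restriction \<open>x(J)\<close> of a
  multi-index \<open>x\<close> is \<open>restrict x J\<close>.
\<close>

definition box :: "(nat \<Rightarrow> nat) \<Rightarrow> nat set \<Rightarrow> (nat \<Rightarrow> nat) set" where
  "box n J = (\<Pi>\<^sub>E j\<in>J. {1..n j})"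

text \<open>The values of a tensor outside \<open>box n {1..d}\<close> are irrelevant throughout.\<close>

definition tensor ::
  "('a, 'm) ring_scheme \<Rightarrow> nat \<Rightarrow> (nat \<Rightarrow> nat) \<Rightarrow> ((nat \<Rightarrow> nat) \<Rightarrow> 'a) \<Rightarrow> bool" where
  "tensor F d n T \<longleftrightarrow> T \<in> box n {1..d} \<rightarrow> carrier F"

definition R_rank_le_one ::
  "('a, 'm) ring_scheme \<Rightarrow> nat \<Rightarrow> (nat \<Rightarrow> nat) \<Rightarrow> nat set set set \<Rightarrow> ((nat \<Rightarrow> nat) \<Rightarrow> 'a) \<Rightarrow> bool" where
  "R_rank_le_one F d n R T \<longleftrightarrow>
     (\<exists>P\<in>R. \<exists>a. (\<forall>J\<in>P. a J \<in> box n J \<rightarrow> carrier F) \<and>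
        (\<forall>x\<in>box n {1..d}. T x = (\<Otimes>\<^bsub>F\<^esub>J\<in>P. a J (restrict x J))))"

definition R_rank ::
  "('a, 'm) ring_scheme \<Rightarrow> nat \<Rightarrow> (nat \<Rightarrow> nat) \<Rightarrow> nat set set set \<Rightarrow> ((nat \<Rightarrow> nat) \<Rightarrow> 'a) \<Rightarrow> nat" where
  "R_rank F d n R T =
     (LEAST k. \<exists>Ts. (\<forall>i<k. tensor F d n (Ts i) \<and> R_rank_le_one F d n R (Ts i)) \<and>
        (\<forall>x\<in>box n {1..d}. T x = (\<Oplus>\<^bsub>F\<^esub>i\<in>{..<k}. Ts i x)))"

definition partition_family :: "nat \<Rightarrow> nat set set set \<Rightarrow> bool" where
  "partition_family d R \<longleftrightarrow> R \<noteq> {} \<and> (\<forall>P\<in>R. partition_on {1..d} P)"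

definition refine :: "nat set set \<Rightarrow> nat set set \<Rightarrow> nat set set" where
  "refine P1 P2 = {J1 \<inter> J2 | J1 J2. J1 \<in> P1 \<and> J2 \<in> P2 \<and> J1 \<inter> J2 \<noteq> {}}"

definition refine_family :: "nat set set set \<Rightarrow> nat set set set \<Rightarrow> nat set set set" where
  "refine_family R1 R2 = {refine P1 P2 | P1 P2. P1 \<in> R1 \<and> P2 \<in> R2}"

text \<open>
  The constant \<open>C\<^sub>d\<^sub>,\<^sub>R\<^sub>1\<^sub>,\<^sub>R\<^sub>2(k\<^sub>1, k\<^sub>2)\<close> has to be the same for all fields, but HOL cannot quantify
  over the type of the field elements below an existential quantifier: in a statement
  \<open>\<exists>C. \<forall>F :: 'a ring. \<dots>\<close> the number \<open>C\<close> could depend on \<open>'a\<close>. It is therefore introduced as a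
  function whose type does not mention \<open>'a\<close>, so that it can depend on its five arguments only.

  Its value is the least bound that is valid for all fields whose carrier is a subset of
  \<open>nat\<close>, that is, up to isomorphism, for all countable fields (of any characteristic). That such
  a bound exists at all, and that it is valid for fields over every type, is not part of the
  definition. Nothing is lost by this choice: any bound that holds over all fields is at least
  this number, and conversely a bound for countable fields holds for all fields, since the
  finitely many values occurring in the decompositions of a given tensor for \<open>R1\<close> and \<open>R2\<close>
  generate a countable subfield, and the rank does not increase from a subfield to the whole
  field.
\<close>

definition refinement_bound ::
  "nat \<Rightarrow> nat set set set \<Rightarrow> nat set set set \<Rightarrow> nat \<Rightarrow> nat \<Rightarrow> nat" where
  "refinement_bound d R1 R2 k1 k2 =
     (LEAST C. \<forall>(F :: nat ring) n T. field F \<longrightarrow> (\<forall>i\<in>{1..d}. n i \<ge> 1) \<longrightarrow> tensor F d n T \<longrightarrow>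
        R_rank F d n R1 T \<le> k1 \<longrightarrow> R_rank F d n R2 T \<le> k2 \<longrightarrow>
        R_rank F d n (refine_family R1 R2) T \<le> C)"

end

theory Submission
  imports Defs "HOL-Algebra.Weak_Morphisms" "HOL-Algebra.Generated_Fields"
    "HOL-Library.Multiset" "HOL-Library.Countable_Set"
begin

text \<open>
  Suppose that for every non-empty \<open>J \<subseteq> [d]\<close> we have a finite family of functions of the
  coordinates in \<open>J\<close>, such that no non-trivial linear combination of the family of \<open>J\<close> is a sum of
  few products along partitions of \<open>J\<close> with at least two parts. Then the products of members of
  these families along partitions of \<open>[d]\<close> are linearly independent: in a vanishing linear
  combination with non-zero coefficients take a part \<open>J\<close> of maximal size; fixing suitable values
  of the coordinates outside \<open>J\<close> leaves a non-trivial combination of the family of \<open>J\<close>, and all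
  the terms in which \<open>J\<close> is not a part become products along non-trivial partitions of \<open>J\<close>.

  Starting with the functions occurring in the two given decompositions of \<open>T\<close>, one reaches such
  families by repeatedly replacing a function, whenever a combination involving it violates the
  condition, by functions on proper subsets of its set of coordinates. The multiset of the sizes of
  the coordinate sets decreases, and there are finitely many ways to proceed in terms of the sizes
  alone, so the number of functions at the end is bounded independently of \<open>T\<close> and of the field.
  Expanding both decompositions in the independent products, the coefficients agree, hence only
  those products occur that refine both a member of \<open>R1\<close> and a member of \<open>R2\<close>.
\<close>

section \<open>Products of labelled functions\<close>

text \<open>
  The label \<open>(J, i)\<close> names the \<open>i\<close>-th function of the coordinates in \<open>J\<close>. A set of labels with
  distinct disjoint first components stands both for a partition and for a choice of one function
  for each part.
\<close>

type_synonym label = "nat set \<times> nat"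

text \<open>The second argument plays two roles: its union is the set of coordinates to be covered,
  and its members limit the parts from above. For a singleton \<open>{S}\<close> only the first
  constraint remains; for a member \<open>P\<close> of a family one obtains the products that refine
  \<open>P\<close>.\<close>

definition subpartitions :: "label set \<Rightarrow> nat set set \<Rightarrow> label set set" where
  "subpartitions U P =
     {q. q \<subseteq> U \<and> inj_on fst q \<and> partition_on (\<Union>P) (fst ` q) \<and> (\<forall>A\<in>fst ` q. \<exists>B\<in>P. A \<subseteq> B)}"

lemma restrict_in_box: "x \<in> box n S \<Longrightarrow> J \<subseteq> S \<Longrightarrow> restrict x J \<in> box n J"
  unfolding box_def by (auto simp: PiE_def)

lemma restrict_restrict_subset: "J \<subseteq> S \<Longrightarrow> restrict (restrict x S) J = restrict x J"
  by (simp add: Int_absorb1)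

lemma box_restrict: "x \<in> box n J \<Longrightarrow> restrict x J = x"
  unfolding box_def by (auto simp: PiE_def extensional_restrict)

lemma finite_box: "finite S \<Longrightarrow> finite (box n S)"
  unfolding box_def by (simp add: finite_PiE)

lemma finite_subpartitions: "finite U \<Longrightarrow> finite (subpartitions U P)"
  unfolding subpartitions_def by (rule finite_subset[of _ "Pow U"]) auto

lemma subpartitions_subset_Pow: "subpartitions U P \<subseteq> Pow U"
  unfolding subpartitions_def by auto

lemma subpartitions_part: "q \<in> subpartitions U P \<Longrightarrow> p \<in> q \<Longrightarrow> fst p \<subseteq> \<Union>P"
  unfolding subpartitions_def partition_on_def by auto

lemma subpartitions_empty: "{} \<in> subpartitions U {}"
  unfolding subpartitions_def by (auto simp: partition_on_def)

lemma subpartitions_single: "p \<in> U \<Longrightarrow> fst p \<noteq> {} \<Longrightarrow> {p} \<in> subpartitions U {fst p}"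
  unfolding subpartitions_def by (auto simp: partition_on_def)

text \<open>Parts are non-empty, so labels over disjoint coordinate sets have different first
  components. This keeps \<open>fst\<close> injective on the union and makes the two label sets
  disjoint, as needed to split a product over them.\<close>

lemma subpartitions_Un:
  assumes "q1 \<in> subpartitions U P1" "q2 \<in> subpartitions U P2" "\<Union>P1 \<inter> \<Union>P2 = {}"
  shows "q1 \<union> q2 \<in> subpartitions U (P1 \<union> P2)" "q1 \<inter> q2 = {}"
proof -
  have ne: "fst p \<noteq> {}" if "p \<in> q1 \<union> q2" for p
    using that assms(1,2) unfolding subpartitions_def partition_on_def by auto
  have disj: "fst p1 \<noteq> fst p2" if "p1 \<in> q1" "p2 \<in> q2" for p1 p2
    using subpartitions_part[OF assms(1) that(1)] subpartitions_part[OF assms(2) that(2)]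
      ne[of p1] that assms(3) by blast
  show "q1 \<inter> q2 = {}" using disj by blast
  have inj: "inj_on fst (q1 \<union> q2)"
    unfolding inj_on_Un using assms(1,2) disj
    unfolding subpartitions_def by (auto simp: image_iff) 
  have part: "partition_on (\<Union>(P1 \<union> P2)) (fst ` (q1 \<union> q2))"
    using assms unfolding subpartitions_def partition_on_def
    by (simp add: image_Un Union_Un_distrib disjoint_union)
  show "q1 \<union> q2 \<in> subpartitions U (P1 \<union> P2)"
    using inj part assms(1,2) unfolding subpartitions_def by blast
qed

lemma subpartitions_mono:
  assumes "\<Union>P = \<Union>P'" "\<And>A. A \<in> P \<Longrightarrow> \<exists>B\<in>P'. A \<subseteq> B"
  shows "subpartitions U P \<subseteq> subpartitions U P'"
proof
  fix q assume q: "q \<in> subpartitions U P"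
  have "\<exists>B\<in>P'. A \<subseteq> B" if A: "A \<in> fst ` q" for A
  proof -
    obtain B where "B \<in> P" "A \<subseteq> B" using q A unfolding subpartitions_def by blast
    then show ?thesis using assms(2)[of B] by blast
  qed
  then show "q \<in> subpartitions U P'" using q assms(1) unfolding subpartitions_def by auto
qed

section \<open>Spans of products and their closure properties\<close>

context field
begin

definition tprod :: "(label \<Rightarrow> (nat \<Rightarrow> nat) \<Rightarrow> 'a) \<Rightarrow> label set \<Rightarrow> (nat \<Rightarrow> nat) \<Rightarrow> 'a" where
  "tprod g q x = (\<Otimes>p\<in>q. g p (restrict x (fst p)))"

definition tsystem :: "(nat \<Rightarrow> nat) \<Rightarrow> label set \<Rightarrow> (label \<Rightarrow> (nat \<Rightarrow> nat) \<Rightarrow> 'a) \<Rightarrow> bool" where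
  "tsystem n U g \<longleftrightarrow> finite U \<and>
     (\<forall>p\<in>U. fst p \<noteq> {} \<and> finite (fst p) \<and> g p \<in> box n (fst p) \<rightarrow> carrier R)"

lemma tsystem_closed: "tsystem n U g \<Longrightarrow> p \<in> U \<Longrightarrow> x \<in> box n (fst p) \<Longrightarrow> g p x \<in> carrier R"
  unfolding tsystem_def by blast

text \<open>The linear span of the products with label set in \<open>Q\<close>, as functions on
  \<open>box n S\<close>. Adding one scaled product at a time lets closure properties be proved by
  rule induction, and both rules ask for agreement on the box only, because values elsewhere carry
  no meaning. \<open>Q\<close> is a parameter of its own because it will also be a union of sets
  \<open>subpartitions U P\<close> over a family of partitions.\<close>

inductive lspan for n g Q S where
  zero: "(\<And>x. x \<in> box n S \<Longrightarrow> f x = \<zero>) \<Longrightarrow> lspan n g Q S f"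
| step: "lspan n g Q S f \<Longrightarrow> q \<in> Q \<Longrightarrow> c \<in> carrier R \<Longrightarrow>
    (\<And>x. x \<in> box n S \<Longrightarrow> h x = c \<otimes> tprod g q x \<oplus> f x) \<Longrightarrow> lspan n g Q S h"

lemma tprod_closed:
  assumes "tsystem n U g" "q \<in> subpartitions U P" "x \<in> box n (\<Union>P)"
  shows "tprod g q x \<in> carrier R"
  unfolding tprod_def
proof (rule finprod_closed, rule Pi_I)
  fix p assume p: "p \<in> q"
  have "p \<in> U" using p assms(2) unfolding subpartitions_def by auto
  then have "g p \<in> box n (fst p) \<rightarrow> carrier R" using assms(1) unfolding tsystem_def by auto
  moreover have "restrict x (fst p) \<in> box n (fst p)"
    using restrict_in_box[OF assms(3) subpartitions_part[OF assms(2) p]] .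
  ultimately show "g p (restrict x (fst p)) \<in> carrier R" by auto
qed

lemma tprod_restrict:
  assumes "tsystem n U g" "q \<in> subpartitions U P" "\<Union>P \<subseteq> S" "x \<in> box n S'" "S \<subseteq> S'"
  shows "tprod g q (restrict x S) = tprod g q x"
  unfolding tprod_def
proof (rule finprod_cong')
  have p: "restrict (restrict x S) (fst p) = restrict x (fst p) \<and>
      g p (restrict x (fst p)) \<in> carrier R" if "p \<in> q" for p
  proof
    have sub: "fst p \<subseteq> S" using subpartitions_part[OF assms(2) that] assms(3) by auto
    then show "restrict (restrict x S) (fst p) = restrict x (fst p)"
      by (rule restrict_restrict_subset)
    have "p \<in> U" using that assms(2) unfolding subpartitions_def by auto
    then show "g p (restrict x (fst p)) \<in> carrier R"
      using assms(1) restrict_in_box[OF assms(4) subset_trans[OF sub assms(5)]] unfolding tsystem_def by auto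
  qed
  show "(\<lambda>p. g p (restrict x (fst p))) \<in> q \<rightarrow> carrier R" using p by auto
  show "g p (restrict (restrict x S) (fst p)) = g p (restrict x (fst p))" if "p \<in> q" for p
    using p[OF that] by simp
qed simp

lemma tprod_Un:
  assumes "tsystem n U g" "q1 \<in> subpartitions U P1" "q2 \<in> subpartitions U P2" 
    "\<Union>P1 \<inter> \<Union>P2 = {}" "x \<in> box n (\<Union>P1 \<union> \<Union>P2)"
  shows "tprod g (q1 \<union> q2) x = tprod g q1 x \<otimes> tprod g q2 x"
proof -
  have fin: "finite q1" "finite q2"
    using assms(1-3) unfolding tsystem_def subpartitions_def by (auto intro: finite_subset)
  have "g p (restrict x (fst p)) \<in> carrier R" if p: "p \<in> q1 \<union> q2" for p
  proof -
    have "p \<in> U" using p assms(2,3) unfolding subpartitions_def by auto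
    then have "g p \<in> box n (fst p) \<rightarrow> carrier R" using assms(1) unfolding tsystem_def by auto
    moreover have "restrict x (fst p) \<in> box n (fst p)"
      using p restrict_in_box[OF assms(5)] subpartitions_part[OF assms(2)]
        subpartitions_part[OF assms(3)] by blast
    ultimately show ?thesis by auto
  qed
  then show ?thesis unfolding tprod_def
    using fin subpartitions_Un(2)[OF assms(2-4)] by (intro finprod_Un_disjoint) auto
qed

lemma lspan_closed:
  assumes "tsystem n U g" "lspan n g Q S f" "Q \<subseteq> subpartitions U P" "S = \<Union>P" "x \<in> box n S"
  shows "f x \<in> carrier R"
  using assms(2)
proof induction
  case (zero f) then show ?case using assms by auto
next
  case (step f q c h)
  have "tprod g q x \<in> carrier R"
    using tprod_closed[OF assms(1)] assms(3-5) step.hyps(2) by blast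
  then show ?case using step assms(5) by simp
qed

lemma lspan_cong:
  assumes "lspan n g Q S f" "\<And>x. x \<in> box n S \<Longrightarrow> f x = h x"
  shows "lspan n g Q S h"
  using assms(1)
proof cases
  case zero then show ?thesis using assms(2) by (intro lspan.zero) metis
next
  case (step f q c) then show ?thesis using assms(2) by (auto intro!: lspan.step[OF step(1-3)])
qed

lemma lspan_mono:
  assumes "lspan n g Q S f" "Q \<subseteq> Q'"
  shows "lspan n g Q' S f"
  using assms(1)
proof induction
  case (zero f) then show ?case by (rule lspan.zero)
next
  case (step f q c h)
  from step.hyps(2) assms(2) have "q \<in> Q'" by auto
  from lspan.step[OF step.IH this step.hyps(3,4)] show ?case .
qed

lemma lspan_scale:
  assumes ts: "tsystem n U g" "Q \<subseteq> subpartitions U P" "S = \<Union>P" and a: "a \<in> carrier R"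
    and f: "lspan n g Q S f"
  shows "lspan n g Q S (\<lambda>x. a \<otimes> f x)"
  using f
proof induction
  case (zero f) then show ?case using a by (intro lspan.zero) auto
next
  case (step f q c h)
  show ?case
  proof (rule lspan.step[OF step.IH step.hyps(2), of "a \<otimes> c"])
    fix x assume x: "x \<in> box n S"
    have "tprod g q x \<in> carrier R" using tprod_closed[OF ts(1)] ts(2,3) step.hyps(2) x by auto
    moreover have "f x \<in> carrier R" using lspan_closed[OF ts(1) step.hyps(1) ts(2,3) x] .
    ultimately show "a \<otimes> h x = a \<otimes> c \<otimes> tprod g q x \<oplus> a \<otimes> f x"
      using step.hyps(4)[OF x] step.hyps(3) a by (simp add: r_distr m_assoc)
  qed (use a step.hyps in auto)
qed

lemma lspan_add:
  assumes ts: "tsystem n U g" "Q \<subseteq> subpartitions U P" "S = \<Union>P"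
    and f: "lspan n g Q S f" and f': "lspan n g Q S f'"
  shows "lspan n g Q S (\<lambda>x. f x \<oplus> f' x)"
  using f
proof induction
  case (zero f)
  show ?case by (rule lspan_cong[OF f']) (use zero lspan_closed[OF ts(1) f' ts(2,3)] in simp)
next
  case (step f q c h)
  show ?case
  proof (rule lspan.step[OF step.IH step.hyps(2,3)])
    fix x assume x: "x \<in> box n S"
    have "tprod g q x \<in> carrier R" using tprod_closed[OF ts(1)] ts(2,3) step.hyps(2) x by auto
    then show "h x \<oplus> f' x = c \<otimes> tprod g q x \<oplus> (f x \<oplus> f' x)"
      using step.hyps(4)[OF x] step.hyps(3) lspan_closed[OF ts(1) step.hyps(1) ts(2,3) x]
        lspan_closed[OF ts(1) f' ts(2,3) x]
      by (simp add: a_assoc)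
  qed
qed

lemma lspan_finsum:
  assumes ts: "tsystem n U g" "Q \<subseteq> subpartitions U P" "S = \<Union>P"
    and "finite I" "\<And>i. i \<in> I \<Longrightarrow> lspan n g Q S (f i)"
  shows "lspan n g Q S (\<lambda>x. \<Oplus>i\<in>I. f i x)"
  using assms(4,5)
proof (induction I)
  case empty then show ?case by (intro lspan.zero) auto
next
  case (insert i I)
  have "lspan n g Q S (\<lambda>x. f i x \<oplus> (\<Oplus>i\<in>I. f i x))"
    using insert by (intro lspan_add[OF ts]) auto
  then show ?case
    by (rule lspan_cong) (subst finsum_insert, use insert lspan_closed[OF ts(1) _ ts(2,3)] in auto)
qed

lemma lspan_tprod:
  assumes "tsystem n U g" "Q \<subseteq> subpartitions U P" "S = \<Union>P" "q \<in> Q"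
  shows "lspan n g Q S (tprod g q)"
  using assms tprod_closed[OF assms(1)]
  by (intro lspan.step[OF lspan.zero[where f = "\<lambda>_. \<zero>"], where q = q and c = \<one>]) auto

text \<open>Two products over disjoint coordinates multiply to the product of the united label set,
  so bilinearity suffices. The induction runs over the second factor with a single product
  \<open>q\<close> on the left (\<open>tq\<close>), then over the first factor.\<close>

lemma lspan_mult:
  assumes ts: "tsystem n U g" and f: "lspan n g (subpartitions U P1) (\<Union>P1) f"
    and h: "lspan n g (subpartitions U P2) (\<Union>P2) h" and disj: "\<Union>P1 \<inter> \<Union>P2 = {}"
  shows "lspan n g (subpartitions U (P1 \<union> P2)) (\<Union>(P1 \<union> P2))
           (\<lambda>x. f (restrict x (\<Union>P1)) \<otimes> h (restrict x (\<Union>P2)))"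
proof -
  let ?Q = "subpartitions U (P1 \<union> P2)" and ?S = "\<Union>(P1 \<union> P2)"
  have b1: "restrict x (\<Union>P1) \<in> box n (\<Union>P1)" and b2: "restrict x (\<Union>P2) \<in> box n (\<Union>P2)"
    if "x \<in> box n ?S" for x using restrict_in_box[OF that] by auto
  have hc: "h (restrict x (\<Union>P2)) \<in> carrier R" if "x \<in> box n ?S" for x
    using lspan_closed[OF ts h order_refl refl b2[OF that]] .
  have tq1: "tprod g q (restrict x (\<Union>P1)) = tprod g q x \<and> tprod g q x \<in> carrier R"
    if "q \<in> subpartitions U P1" "x \<in> box n ?S" for q x
    using tprod_closed[OF ts that(1) b1[OF that(2)]]
      tprod_restrict[OF ts that(1) order_refl that(2)] by auto
  have tq2: "tprod g q (restrict x (\<Union>P2)) = tprod g q x \<and> tprod g q x \<in> carrier R"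
    if "q \<in> subpartitions U P2" "x \<in> box n ?S" for q x
    using tprod_closed[OF ts that(1) b2[OF that(2)]]
      tprod_restrict[OF ts that(1) order_refl that(2)] by auto
  have tq: "lspan n g ?Q ?S (\<lambda>x. tprod g q x \<otimes> h (restrict x (\<Union>P2)))"
    if q: "q \<in> subpartitions U P1" for q
    using h
  proof induction
    case (zero h)
    show ?case
    proof (rule lspan.zero)
      fix x assume x: "x \<in> box n ?S"
      show "tprod g q x \<otimes> h (restrict x (\<Union>P2)) = \<zero>"
        using tq1[OF q x] zero[OF b2[OF x]] by simp
    qed
  next
    case (step h q' c h')
    show ?case
    proof (rule lspan.step[OF step.IH _ step.hyps(3)])
      show "q \<union> q' \<in> ?Q" using subpartitions_Un[OF q step.hyps(2) disj] by auto
      fix x assume x: "x \<in> box n ?S"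
      have "tprod g q x \<in> carrier R" "tprod g q' x \<in> carrier R" 
        using tq1[OF q x] tq2[OF step.hyps(2) x] by auto
      moreover have "h (restrict x (\<Union>P2)) \<in> carrier R"
        using lspan_closed[OF ts step.hyps(1) order_refl refl b2[OF x]] .
      moreover have "tprod g (q \<union> q') x = tprod g q x \<otimes> tprod g q' x"
        using tprod_Un[OF ts q step.hyps(2) disj] x by (simp add: Union_Un_distrib)
      moreover have "h' (restrict x (\<Union>P2)) = c \<otimes> tprod g q' x \<oplus> h (restrict x (\<Union>P2))"
        using step.hyps(4)[OF b2[OF x]] tq2[OF step.hyps(2) x] by simp
      ultimately show "tprod g q x \<otimes> h' (restrict x (\<Union>P2)) =
          c \<otimes> tprod g (q \<union> q') x \<oplus> tprod g q x \<otimes> h (restrict x (\<Union>P2))"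
        using step.hyps(3) by (simp add: r_distr m_lcomm)
    qed
  qed
  show ?thesis
    using f
  proof induction
    case (zero f)
    show ?case
    proof (rule lspan.zero)
      fix x assume x: "x \<in> box n ?S"
      show "f (restrict x (\<Union>P1)) \<otimes> h (restrict x (\<Union>P2)) = \<zero>"
        using hc[OF x] zero[OF b1[OF x]] by simp
    qed
  next
    case (step f q c f')
    have "lspan n g ?Q ?S (\<lambda>x. c \<otimes> (tprod g q x \<otimes> h (restrict x (\<Union>P2))) \<oplus>
        f (restrict x (\<Union>P1)) \<otimes> h (restrict x (\<Union>P2)))"
      by (intro lspan_add[OF ts order_refl refl] lspan_scale[OF ts order_refl refl] step tq)
    then show ?case
    proof (rule lspan_cong)
      fix x assume x: "x \<in> box n ?S"
      have "tprod g q x \<in> carrier R"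
        using tq1[OF step.hyps(2) x] by simp
      moreover have "f (restrict x (\<Union>P1)) \<in> carrier R"
        using lspan_closed[OF ts step.hyps(1) order_refl refl b1[OF x]] .
      moreover have "f' (restrict x (\<Union>P1)) = c \<otimes> tprod g q x \<oplus> f (restrict x (\<Union>P1))"
        using step.hyps(4)[OF b1[OF x]] tq1[OF step.hyps(2) x] by simp
      ultimately show "c \<otimes> (tprod g q x \<otimes> h (restrict x (\<Union>P2))) \<oplus>
        f (restrict x (\<Union>P1)) \<otimes> h (restrict x (\<Union>P2)) =
        f' (restrict x (\<Union>P1)) \<otimes> h (restrict x (\<Union>P2))"
        using step.hyps(3) hc[OF x] by (simp add: l_distr m_assoc)
    qed
  qed
qed

text \<open>Iterates \<open>lspan_mult\<close>. The coordinate sets form an indexed family so that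
  the index may be a label (\<open>A = fst\<close>, in \<open>lspan_subst\<close>) or a part itself
  (\<open>A\<close> the identity, in \<open>lspan_rank_sum\<close>).\<close>

lemma lspan_finprod:
  assumes ts: "tsystem n U g" and "finite I" "disjoint_family_on A I"
    "\<And>i. i \<in> I \<Longrightarrow> lspan n g (subpartitions U {A i}) (A i) (f i)"
  shows "lspan n g (subpartitions U (A ` I)) (\<Union>(A ` I)) (\<lambda>x. \<Otimes>i\<in>I. f i (restrict x (A i)))"
  using assms(2-4)
proof (induction I)
  case empty
  \<comment> \<open>The empty product is the constant one, which is the product of the empty label
    set over no coordinates.\<close>
  have "lspan n g (subpartitions U {}) (\<Union>{}) (tprod g {})"
    by (rule lspan_tprod[OF ts order_refl refl subpartitions_empty])
  then show ?case by (simp add: tprod_def[abs_def])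
next
  case (insert i I)
  have disj: "\<Union>{A i} \<inter> \<Union>(A ` I) = {}"
    using insert.prems(1) insert.hyps(2) unfolding disjoint_family_on_def by auto
  have IH: "lspan n g (subpartitions U (A ` I)) (\<Union>(A ` I)) (\<lambda>x. \<Otimes>i\<in>I. f i (restrict x (A i)))"
    using insert.prems by (intro insert.IH) (auto simp: disjoint_family_on_def)
  have "lspan n g (subpartitions U {A i}) (\<Union>{A i}) (f i)" using insert.prems(2)[of i] by simp
  from lspan_mult[OF ts this IH disj]
  have "lspan n g (subpartitions U (A ` insert i I)) (\<Union>(A ` insert i I))
     (\<lambda>x. f i (restrict x (A i)) \<otimes> (\<Otimes>j\<in>I. f j (restrict (restrict x (\<Union>(A ` I))) (A j))))"
    by simp
  then show ?case
  proof (rule lspan_cong)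
    fix x assume x: "x \<in> box n (\<Union>(A ` insert i I))"
    have c: "f j (restrict x (A j)) \<in> carrier R" if "j \<in> insert i I" for j
    proof -
      have "restrict x (A j) \<in> box n (A j)" using restrict_in_box[OF x] that by auto
      then show ?thesis using lspan_closed[OF ts insert.prems(2)[OF that] order_refl] by simp
    qed
    \<comment> \<open>\<open>lspan_mult\<close> restricts first to the union and then to
      \<open>A j\<close>; the two restrictions collapse because \<open>A j\<close> lies in the
      union.\<close>
    have "(\<Otimes>j\<in>I. f j (restrict (restrict x (\<Union>(A ` I))) (A j))) = (\<Otimes>j\<in>I. f j (restrict x (A j)))"
      using c by (intro finprod_cong') (auto simp: restrict_restrict_subset UN_upper simp del: restrict_restrict)
    then show "f i (restrict x (A i)) \<otimes> (\<Otimes>j\<in>I. f j (restrict (restrict x (\<Union>(A ` I))) (A j))) =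
      (\<Otimes>j\<in>insert i I. f j (restrict x (A j)))"
      using insert.hyps c by (subst finprod_insert) auto
  qed
qed

text \<open>Each factor of a product is replaced by its expansion in \<open>g'\<close>; multiplying
  out over the disjoint parts of \<open>q\<close> gives label sets that refine the parts of
  \<open>q\<close>, hence also \<open>P\<close>. Being expressible is thus transitive, so
  replacement steps can be chained.\<close>

lemma lspan_subst:
  assumes ts: "tsystem n U' g'" "finite U"
    and sub: "\<And>p. p \<in> U \<Longrightarrow> lspan n g' (subpartitions U' {fst p}) (fst p) (g p)"
    and f: "lspan n g (subpartitions U P) (\<Union>P) f"
  shows "lspan n g' (subpartitions U' P) (\<Union>P) f"
  using f
proof induction
  case (zero f) then show ?case by (rule lspan.zero)
next
  case (step f q c h)
  have q: "q \<subseteq> U" "inj_on fst q" "partition_on (\<Union>P) (fst ` q)" "\<forall>A\<in>fst ` q. \<exists>B\<in>P. A \<subseteq> B"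
    using step.hyps(2) unfolding subpartitions_def by auto
  have "disjoint_family_on fst q"
    unfolding disjoint_family_on_def
    using q(2) disjointD[OF partition_onD2[OF q(3)]] by (metis image_eqI inj_onD)
  then have "lspan n g' (subpartitions U' (fst ` q)) (\<Union>(fst ` q)) (tprod g q)"
    unfolding tprod_def using q(1) ts(2) sub
    by (intro lspan_finprod[OF ts(1)]) (auto intro: finite_subset)
  moreover have un: "\<Union>(fst ` q) = \<Union>P" using q(3) unfolding partition_on_def by auto
  ultimately have "lspan n g' (subpartitions U' P) (\<Union>P) (tprod g q)"
    using subpartitions_mono[OF un] q(4) by (metis lspan_mono)
  then have "lspan n g' (subpartitions U' P) (\<Union>P) (\<lambda>x. c \<otimes> tprod g q x \<oplus> f x)"
    by (intro lspan_add[OF ts(1) order_refl refl] lspan_scale[OF ts(1) order_refl refl] step)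
  then show ?case by (rule lspan_cong) (use step.hyps(4) in auto)
qed

text \<open>Two expansions of one tensor are to be compared coefficient by coefficient. Hence the
  coefficients are indexed by all of \<open>subpartitions U P\<close>, and \<open>Q\<close> shows
  only in where they vanish.\<close>

lemma lspan_coeffs:
  assumes ts: "tsystem n U g" "Q \<subseteq> subpartitions U P" "S = \<Union>P" and f: "lspan n g Q S f"
  shows "\<exists>\<alpha>. \<alpha> \<in> (UNIV :: label set set) \<rightarrow> carrier R \<and> (\<forall>q. q \<notin> Q \<longrightarrow> \<alpha> q = \<zero>) \<and>
           (\<forall>x\<in>box n S. f x = (\<Oplus>q\<in>subpartitions U P. \<alpha> q \<otimes> tprod g q x))"
  using f
proof induction
  case (zero f)
  have "(\<Oplus>q\<in>subpartitions U P. \<zero> \<otimes> tprod g q x) = (\<Oplus>q\<in>subpartitions U P. \<zero>)"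
    if "x \<in> box n S" for x
    using tprod_closed[OF ts(1)] that ts(3) by (intro finsum_cong') auto
  then show ?case using zero by (intro exI[of _ "\<lambda>_. \<zero>"]) auto
next
  case (step f q c h)
  have fin: "finite (subpartitions U P)"
    using ts(1) finite_subpartitions unfolding tsystem_def by auto
  obtain \<alpha> where \<alpha>: "\<alpha> \<in> (UNIV :: label set set) \<rightarrow> carrier R" "\<forall>q. q \<notin> Q \<longrightarrow> \<alpha> q = \<zero>"
    "\<forall>x\<in>box n S. f x = (\<Oplus>q\<in>subpartitions U P. \<alpha> q \<otimes> tprod g q x)"
    using step.IH by blast
  \<comment> \<open>Adding a multiple of the product of \<open>q\<close> changes the coefficient at
    \<open>q\<close> only, whether or not \<open>q\<close> has occurred before.\<close>
  let ?\<beta> = "\<lambda>r. (if r = q then c else \<zero>) \<oplus> \<alpha> r"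
  have q: "q \<in> subpartitions U P" using step.hyps(2) ts(2) by auto
  have \<alpha>c: "\<alpha> r \<in> carrier R" for r using \<alpha>(1) by auto
  have "h x = (\<Oplus>r\<in>subpartitions U P. ?\<beta> r \<otimes> tprod g r x)" if x: "x \<in> box n S" for x
  proof -
    have t: "tprod g r x \<in> carrier R" if "r \<in> subpartitions U P" for r
      using tprod_closed[OF ts(1) that] x ts(3) by simp
    have "(\<Oplus>r\<in>subpartitions U P. ?\<beta> r \<otimes> tprod g r x) =
      (\<Oplus>r\<in>subpartitions U P. (if q = r then c \<otimes> tprod g r x else \<zero>) \<oplus> \<alpha> r \<otimes> tprod g r x)"
      using t step.hyps(3) \<alpha>c by (intro finsum_cong') (auto simp: l_distr)
    also have "\<dots> = (\<Oplus>r\<in>subpartitions U P. if q = r then c \<otimes> tprod g r x else \<zero>) \<oplus>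
      (\<Oplus>r\<in>subpartitions U P. \<alpha> r \<otimes> tprod g r x)"
      using t step.hyps(3) \<alpha>c by (intro finsum_addf) auto
    also have "(\<Oplus>r\<in>subpartitions U P. if q = r then c \<otimes> tprod g r x else \<zero>) = c \<otimes> tprod g q x"
      using t step.hyps(3) q fin by (intro finsum_singleton) auto
    finally show ?thesis using step.hyps(4)[OF x] \<alpha>(3) x by simp
  qed
  moreover have "?\<beta> \<in> UNIV \<rightarrow> carrier R" using \<alpha>c step.hyps(3) by auto
  moreover have "?\<beta> r = \<zero>" if "r \<notin> Q" for r using \<alpha>(2) that step.hyps(2) by auto
  ultimately show ?case by (intro exI[of _ ?\<beta>]) blast
qed

end

section \<open>Linear independence of the products\<close>

lemma subpartitions_singleton:
  "subpartitions U {S} = {q. q \<subseteq> U \<and> inj_on fst q \<and> partition_on S (fst ` q)}"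
  unfolding subpartitions_def by (auto simp: partition_on_def)

text \<open>Together with \<open>subpartitions_remove\<close> this is the bijection, for a fixed
  label \<open>(J, i)\<close>, between the label sets over \<open>S\<close> containing it and those
  over \<open>S - J\<close>.\<close>

lemma subpartitions_insert:
  assumes "r \<in> subpartitions U {S - J}" "(J, i) \<in> U" "J \<subseteq> S" "J \<noteq> {}"
  shows "insert (J, i) r \<in> subpartitions U {S}" "J \<notin> fst ` r"
proof -
  show n: "J \<notin> fst ` r" using assms unfolding subpartitions_singleton partition_on_def by fastforce
  have "partition_on (S - J) (fst ` r)" using assms(1) unfolding subpartitions_singleton by auto
  then have "partition_on S (insert J (fst ` r))"
    by (subst partition_on_insert) (use assms(3,4) in \<open>auto simp: partition_on_def disjnt_def\<close>)
  then show "insert (J, i) r \<in> subpartitions U {S}"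
    using assms n unfolding subpartitions_singleton by auto
qed

lemma subpartitions_remove:
  assumes "q \<in> subpartitions U {S}" "(J, i) \<in> q"
  shows "q - {(J, i)} \<in> subpartitions U {S - J}"
proof -
  have q: "q \<subseteq> U" "inj_on fst q" "partition_on S (fst ` q)"
    using assms(1) unfolding subpartitions_singleton by auto
  have im: "fst ` (q - {(J, i)}) = fst ` q - {J}"
    using inj_on_image_set_diff[OF q(2), of q "{(J, i)}"] assms(2) by simp
  have J: "J \<in> fst ` q" using assms(2) by force
  have "partition_on S (insert J (fst ` q - {J}))" using q(3) J by (simp add: insert_absorb)
  moreover have "disjnt J (\<Union>(fst ` q - {J}))"
    using q(3) J unfolding partition_on_def disjoint_def disjnt_def by auto
  ultimately have "partition_on (S - J) (fst ` q - {J})" by (subst (asm) partition_on_insert) auto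
  then show ?thesis using q im unfolding subpartitions_singleton by (auto intro: inj_on_subset)
qed

section \<open>Slices of products along a set of coordinates\<close>

definition merge :: "nat set \<Rightarrow> nat set \<Rightarrow> (nat \<Rightarrow> nat) \<Rightarrow> (nat \<Rightarrow> nat) \<Rightarrow> nat \<Rightarrow> nat" where
  "merge S J x y = (\<lambda>j\<in>S. if j \<in> J then x j else y j)"

text \<open>Only the coordinates of \<open>x\<close> in \<open>K \<inter> J\<close> enter, so
  \<open>x\<close> may be a multi-index on that intersection; \<open>tprod_merge\<close> relies on
  this for its factors on parts cut down to \<open>J\<close>.\<close>

lemma merge_in_box:
  "K \<subseteq> S \<Longrightarrow> x \<in> box n (K \<inter> J) \<Longrightarrow> y \<in> box n (S - J) \<Longrightarrow> restrict (merge S J x y) K \<in> box n K"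
  unfolding box_def merge_def by (auto simp: PiE_def Pi_def)

context field
begin

text \<open>
  The partitions must be different from \<open>{J}\<close>, so for a singleton \<open>J\<close> only the zero function is of
  low rank.
\<close>

definition low_rank :: "(nat \<Rightarrow> nat) \<Rightarrow> nat set \<Rightarrow> nat \<Rightarrow> ((nat \<Rightarrow> nat) \<Rightarrow> 'a) \<Rightarrow> bool" where
  "low_rank n J N f \<longleftrightarrow> (\<exists>m\<le>N. \<exists>\<gamma> P b.
     (\<forall>l<m. \<gamma> l \<in> carrier R \<and> partition_on J (P l) \<and> J \<notin> P l \<and>
        (\<forall>K\<in>P l. b l K \<in> box n K \<rightarrow> carrier R)) \<and>
     (\<forall>x\<in>box n J. f x = (\<Oplus>l\<in>{..<m}. \<gamma> l \<otimes> (\<Otimes>K\<in>P l. b l K (restrict x K)))))"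

text \<open>Linear independence modulo functions of low rank, for each \<open>J\<close> separately;
  the case \<open>m = 0\<close> of \<open>low_rank\<close> includes ordinary independence. The
  threshold will be \<open>card (Pow U)\<close>, which bounds the number of products over
  \<open>U\<close>.\<close>

definition regular :: "(nat \<Rightarrow> nat) \<Rightarrow> label set \<Rightarrow> (label \<Rightarrow> (nat \<Rightarrow> nat) \<Rightarrow> 'a) \<Rightarrow> nat \<Rightarrow> bool" where
  "regular n U g N \<longleftrightarrow> (\<forall>J c. c \<in> UNIV \<rightarrow> carrier R \<longrightarrow>
     low_rank n J N (\<lambda>x. \<Oplus>i\<in>{i. (J, i) \<in> U}. c i \<otimes> g (J, i) x) \<longrightarrow>
     (\<forall>i. (J, i) \<in> U \<longrightarrow> c i = \<zero>))"

text \<open>With the coordinates outside \<open>J\<close> frozen at \<open>y\<close>, a part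
  disjoint from \<open>J\<close> becomes a scalar and every other part is cut down to its trace on
  \<open>J\<close>. The traces partition \<open>J\<close>, and \<open>J\<close> itself is a trace
  only if some part contains it.\<close>

lemma tprod_merge:
  assumes ts: "tsystem n U g" and q: "q \<in> subpartitions U {S}" and J: "J \<subseteq> S"
    and y: "y \<in> box n (S - J)"
  obtains \<gamma> P b where "\<gamma> \<in> carrier R" "partition_on J P" "J \<in> P \<Longrightarrow> \<exists>K\<in>fst ` q. J \<subseteq> K"
    "\<forall>K\<in>P. b K \<in> box n K \<rightarrow> carrier R"
    "\<forall>x\<in>box n J. tprod g q (merge S J x y) = \<gamma> \<otimes> (\<Otimes>K\<in>P. b K (restrict x K))"
proof -
  have qU: "q \<subseteq> U" "inj_on fst q" "partition_on S (fst ` q)"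
    using q unfolding subpartitions_singleton by auto
  have fin: "finite q" using qU(1) ts unfolding tsystem_def by (auto intro: finite_subset)
  define q0 where "q0 = {p \<in> q. fst p \<inter> J = {}}"
  define q1 where "q1 = {p \<in> q. fst p \<inter> J \<noteq> {}}"
  have q01: "q = q0 \<union> q1" "q0 \<inter> q1 = {}" unfolding q0_def q1_def by auto
  have fin01: "finite q0" "finite q1" using fin q01(1) by auto
  have sub: "fst p \<subseteq> S" if "p \<in> q" for p using subpartitions_part[OF q that] by simp
  have gc: "g p z \<in> carrier R" if "p \<in> q" "z \<in> box n (fst p)" for p z
    using that qU(1) ts unfolding tsystem_def by auto
  let ?cut = "\<lambda>p :: label. J \<inter> fst p"
  \<comment> \<open>A common trace would be a non-empty intersection of two parts. Hence a trace
    determines the label it comes from.\<close>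
  have inj: "inj_on ?cut q1"
  proof (rule inj_onI)
    fix p p' assume p: "p \<in> q1" "p' \<in> q1" "J \<inter> fst p = J \<inter> fst p'"
    then have "fst p \<inter> fst p' \<noteq> {}" "p \<in> q" "p' \<in> q" unfolding q1_def by auto
    then have "fst p = fst p'"
      using disjointD[OF partition_onD2[OF qU(3)], of "fst p" "fst p'"] by auto
    then show "p = p'" using qU(2) \<open>p \<in> q\<close> \<open>p' \<in> q\<close> by (auto dest: inj_onD)
  qed
  define P where "P = ?cut ` q1"
  have P_eq: "P = (\<inter>) J ` (fst ` q) - {{}}"
    unfolding P_def q1_def by auto
  define \<gamma> where "\<gamma> = (\<Otimes>p\<in>q0. g p (restrict y (fst p)))"
  \<comment> \<open>The factor on a trace \<open>K\<close> evaluates the function of the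
    corresponding label, with \<open>y\<close> supplying the coordinates outside
    \<open>J\<close>.\<close>
  define b where "b K z = (let p = the_inv_into q1 ?cut K in g p (restrict (merge S J z y) (fst p)))" for K z
  have b: "b (?cut p) z = g p (restrict (merge S J z y) (fst p))" if "p \<in> q1" for p z
    unfolding b_def using the_inv_into_f_f[OF inj that] by simp
  have inbox: "restrict (merge S J z y) (fst p) \<in> box n (fst p)" if "p \<in> q" "z \<in> box n (J \<inter> fst p)" for p z
    using merge_in_box[OF sub[OF that(1)] _ y] that(2) by (simp add: Int_commute)
  have g0: "g p (restrict y (fst p)) \<in> carrier R" if "p \<in> q0" for p
  proof -
    have "p \<in> q" "fst p \<subseteq> S - J" using that sub[of p] unfolding q0_def by blast+
    then show ?thesis by (intro gc restrict_in_box[OF y])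
  qed
  show ?thesis
  proof
    show "\<gamma> \<in> carrier R" unfolding \<gamma>_def using g0 by (intro finprod_closed) auto
    show "partition_on J P"
      using partition_on_restrict[OF qU(3), of J] J unfolding P_eq by (simp add: Int_absorb2)
    show "\<exists>K\<in>fst ` q. J \<subseteq> K" if "J \<in> P" using that unfolding P_eq by blast
    show "\<forall>K\<in>P. b K \<in> box n K \<rightarrow> carrier R"
      unfolding P_def using b inbox gc by (auto simp: q1_def)
    show "\<forall>x\<in>box n J. tprod g q (merge S J x y) = \<gamma> \<otimes> (\<Otimes>K\<in>P. b K (restrict x K))"
    proof
      fix x assume x: "x \<in> box n J"
      let ?z = "merge S J x y"
      have zc: "g p (restrict ?z (fst p)) \<in> carrier R" if "p \<in> q" for p
      proof -
        \<comment> \<open>On the coordinates in \<open>fst p\<close> the merged point depends on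
          \<open>x\<close> only through the trace.\<close>
        have "restrict ?z (fst p) = restrict (merge S J (restrict x (J \<inter> fst p)) y) (fst p)"
          using sub[OF that] by (auto simp: merge_def restrict_def fun_eq_iff)
        then show ?thesis
          using gc[OF that inbox[OF that restrict_in_box[OF x]]] by simp
      qed
      have "tprod g q ?z = (\<Otimes>p\<in>q0. g p (restrict ?z (fst p))) \<otimes> (\<Otimes>p\<in>q1. g p (restrict ?z (fst p)))"
        unfolding tprod_def using q01 fin01 zc by (metis (no_types, lifting) Pi_I UnCI finprod_Un_disjoint)
      also have "(\<Otimes>p\<in>q0. g p (restrict ?z (fst p))) = \<gamma>"
        unfolding \<gamma>_def
      proof (rule finprod_cong')
        show "g p (restrict ?z (fst p)) = g p (restrict y (fst p))" if "p \<in> q0" for p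
        proof -
          have "restrict ?z (fst p) = restrict y (fst p)"
            using that sub[of p] unfolding q0_def by (auto simp: merge_def restrict_def fun_eq_iff)
          then show ?thesis by simp
        qed
      qed (use g0 in auto)
      also have "(\<Otimes>p\<in>q1. g p (restrict ?z (fst p))) = (\<Otimes>p\<in>q1. b (?cut p) (restrict x (?cut p)))"
      proof (rule finprod_cong')
        have eq: "g p (restrict ?z (fst p)) = b (?cut p) (restrict x (?cut p))" if "p \<in> q1" for p
        proof -
          have "restrict ?z (fst p) = restrict (merge S J (restrict x (J \<inter> fst p)) y) (fst p)"
            using that sub[of p] q01(1) by (auto simp: merge_def restrict_def fun_eq_iff)
          then show ?thesis using b[OF that] by simp
        qed
        then show "p \<in> q1 \<Longrightarrow> g p (restrict ?z (fst p)) = b (?cut p) (restrict x (?cut p))" for p .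
        show "(\<lambda>p. b (?cut p) (restrict x (?cut p))) \<in> q1 \<rightarrow> carrier R"
          using eq zc q01(1) by (metis (no_types, lifting) Pi_I UnI2)
      qed simp
      also have "\<dots> = (\<Otimes>K\<in>P. b K (restrict x K))"
        unfolding P_def
      proof (rule finprod_reindex[symmetric, OF _ inj])
        show "(\<lambda>K. b K (restrict x K)) \<in> ?cut ` q1 \<rightarrow> carrier R"
        proof clarify
          fix p assume p: "p \<in> q1"
          then have pq: "p \<in> q" using q01(1) by auto
          show "b (?cut p) (restrict x (?cut p)) \<in> carrier R"
            unfolding b[OF p] by (rule gc[OF pq inbox[OF pq restrict_in_box[OF x]]]) simp
        qed
      qed
      finally show "tprod g q ?z = \<gamma> \<otimes> (\<Otimes>K\<in>P. b K (restrict x K))" .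
    qed
  qed
qed

text \<open>By \<open>tprod_merge\<close> each product slices to a scalar times a product along a
  partition of \<open>J\<close>, and \<open>cut\<close> rules out the trivial partition. Each member
  of \<open>B\<close> thus contributes one term.\<close>

lemma low_rank_slices:
  assumes ts: "tsystem n U g" and B: "B \<subseteq> subpartitions U {S}" and J: "J \<subseteq> S" 
    and y: "y \<in> box n (S - J)" and cut: "\<And>q. q \<in> B \<Longrightarrow> \<not> (\<exists>K\<in>fst ` q. J \<subseteq> K)"
    and \<alpha>: "\<alpha> \<in> UNIV \<rightarrow> carrier R"
    and f: "\<And>x. x \<in> box n J \<Longrightarrow> f x = (\<Oplus>q\<in>B. \<alpha> q \<otimes> tprod g q (merge S J x y))"
  shows "low_rank n J (card B) f"
proof -
  have finU: "finite U" using ts unfolding tsystem_def by auto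
  have fin: "finite B" using finite_subset[OF B finite_subpartitions[OF finU]] .
  define good where "good q \<gamma> P b \<longleftrightarrow> \<gamma> \<in> carrier R \<and> partition_on J P \<and> J \<notin> P \<and>
     (\<forall>K\<in>P. b K \<in> box n K \<rightarrow> carrier R) \<and>
     (\<forall>x\<in>box n J. tprod g q (merge S J x y) = \<gamma> \<otimes> (\<Otimes>K\<in>P. b K (restrict x K)))" for q \<gamma> P b
  have "\<exists>\<gamma> P b. good q \<gamma> P b" if q: "q \<in> B" for q
  proof -
    obtain \<gamma> P b where "\<gamma> \<in> carrier R" "partition_on J P" "J \<in> P \<Longrightarrow> \<exists>K\<in>fst ` q. J \<subseteq> K"
      "\<forall>K\<in>P. b K \<in> box n K \<rightarrow> carrier R"
      "\<forall>x\<in>box n J. tprod g q (merge S J x y) = \<gamma> \<otimes> (\<Otimes>K\<in>P. b K (restrict x K))"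
      by (rule tprod_merge[OF ts subsetD[OF B q] J y]) (rule that)
    then have "good q \<gamma> P b" unfolding good_def using cut[OF q] by blast
    then show ?thesis by blast
  qed
  then obtain \<gamma> P b where "\<And>q. q \<in> B \<Longrightarrow> good q (\<gamma> q) (P q) (b q)" by metis
  note H = this[unfolded good_def]
  \<comment> \<open>\<open>low_rank\<close> indexes its terms by an initial segment of the naturals,
    so \<open>B\<close> is enumerated.\<close>
  obtain h where h: "bij_betw h {0..<card B} B" using ex_bij_betw_nat_finite[OF fin] by auto
  have hB: "h l \<in> B" if "l < card B" for l using h that by (auto simp: bij_betw_def)
  have prodc: "(\<Otimes>K\<in>P q. b q K (restrict x K)) \<in> carrier R" if "q \<in> B" "x \<in> box n J" for q x
  proof (rule finprod_closed, rule Pi_I)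
    fix K assume K: "K \<in> P q"
    then have "K \<subseteq> J" using H[OF that(1)] unfolding partition_on_def by auto
    then have "restrict x K \<in> box n K" using restrict_in_box that by blast
    then show "b q K (restrict x K) \<in> carrier R" using H[OF that(1)] K by auto
  qed
  have \<alpha>c: "\<alpha> q \<in> carrier R" for q using \<alpha> by auto
  have \<gamma>c: "\<gamma> q \<in> carrier R" if "q \<in> B" for q using H[OF that] by blast
  show ?thesis
    unfolding low_rank_def
  proof (intro exI conjI ballI)
    show "card B \<le> card B" ..
    show "\<forall>l<card B. \<alpha> (h l) \<otimes> \<gamma> (h l) \<in> carrier R \<and> partition_on J (P (h l)) \<and> J \<notin> P (h l) \<and>
        (\<forall>K\<in>P (h l). b (h l) K \<in> box n K \<rightarrow> carrier R)"
      using H hB \<alpha>c by simp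
    fix x assume x: "x \<in> box n J"
    have "f x = (\<Oplus>q\<in>B. \<alpha> q \<otimes> \<gamma> q \<otimes> (\<Otimes>K\<in>P q. b q K (restrict x K)))"
      unfolding f[OF x]
    proof (rule finsum_cong')
      fix q assume q: "q \<in> B"
      have "tprod g q (merge S J x y) = \<gamma> q \<otimes> (\<Otimes>K\<in>P q. b q K (restrict x K))"
        using H[OF q] x by blast
      then show "\<alpha> q \<otimes> tprod g q (merge S J x y) = \<alpha> q \<otimes> \<gamma> q \<otimes> (\<Otimes>K\<in>P q. b q K (restrict x K))"
        using m_assoc[OF \<alpha>c \<gamma>c[OF q] prodc[OF q x]] by simp
    next
      show "(\<lambda>q. \<alpha> q \<otimes> \<gamma> q \<otimes> (\<Otimes>K\<in>P q. b q K (restrict x K))) \<in> B \<rightarrow> carrier R"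
        by (intro Pi_I m_closed \<alpha>c \<gamma>c prodc x)
    qed simp
    also have "\<dots> = (\<Oplus>q\<in>h ` {..<card B}. \<alpha> q \<otimes> \<gamma> q \<otimes> (\<Otimes>K\<in>P q. b q K (restrict x K)))"
      using h by (simp add: bij_betw_def lessThan_atLeast0)
    also have "\<dots> = (\<Oplus>l\<in>{..<card B}. \<alpha> (h l) \<otimes> \<gamma> (h l) \<otimes> (\<Otimes>K\<in>P (h l). b (h l) K (restrict x K)))"
    proof (rule finsum_reindex)
      show "(\<lambda>q. \<alpha> q \<otimes> \<gamma> q \<otimes> (\<Otimes>K\<in>P q. b q K (restrict x K))) \<in> h ` {..<card B} \<rightarrow> carrier R"
      proof clarify
        fix l assume "l < card B"
        then have "h l \<in> B" by (rule hB)
        then show "\<alpha> (h l) \<otimes> \<gamma> (h l) \<otimes> (\<Otimes>K\<in>P (h l). b (h l) K (restrict x K)) \<in> carrier R"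
          by (intro m_closed \<alpha>c \<gamma>c prodc x)
      qed
      show "inj_on h {..<card B}" using h by (simp add: bij_betw_def lessThan_atLeast0)
    qed
    finally show "f x = (\<Oplus>l\<in>{..<card B}. \<alpha> (h l) \<otimes> \<gamma> (h l) \<otimes> (\<Otimes>K\<in>P (h l). b (h l) K (restrict x K)))" .
  qed
qed

lemma low_rank_mono: "low_rank n J N f \<Longrightarrow> N \<le> N' \<Longrightarrow> low_rank n J N' f"
  unfolding low_rank_def
  by (elim exE conjE, rule exI, rule conjI, erule order_trans, assumption) (intro exI conjI)

text \<open>The part \<open>J\<close> sees only \<open>x\<close> and the parts in \<open>r\<close>
  see only \<open>y\<close>, so the product separates.\<close>

lemma tprod_merge_insert:
  assumes ts: "tsystem n U g" and r: "r \<in> subpartitions U {S - J}" and J: "J \<subseteq> S" "J \<noteq> {}" "(J, i) \<in> U"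
    and x: "x \<in> box n J" and y: "y \<in> box n (S - J)"
  shows "tprod g (insert (J, i) r) (merge S J x y) = g (J, i) x \<otimes> tprod g r y"
proof -
  have z: "merge S J x y \<in> box n S"
    using x y J unfolding box_def merge_def by (auto simp: PiE_def Pi_def)
  have J': "{(J, i)} \<in> subpartitions U {J}" using subpartitions_single[of "(J, i)"] J by auto
  have "tprod g ({(J, i)} \<union> r) (merge S J x y) =
      tprod g {(J, i)} (merge S J x y) \<otimes> tprod g r (merge S J x y)"
    by (rule tprod_Un[OF ts J' r]) (use J z in \<open>auto simp: Un_absorb1\<close>)
  also have "restrict (merge S J x y) (S - J) = y"
    using y unfolding merge_def box_def by (auto simp: fun_eq_iff PiE_def extensional_def)
  then have "tprod g r (merge S J x y) = tprod g r y"
    using tprod_restrict[OF ts r _ z, of "S - J"] by simp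
  also have "restrict (merge S J x y) J = x"
    using x J unfolding merge_def box_def by (auto simp: fun_eq_iff PiE_def extensional_def)
  then have "tprod g {(J, i)} (merge S J x y) = g (J, i) x"
  proof -
    have "g (J, i) x \<in> carrier R" using tsystem_closed[OF ts J(3)] x by simp
    then show ?thesis using \<open>restrict (merge S J x y) J = x\<close> unfolding tprod_def by simp
  qed
  finally show ?thesis by simp
qed

text \<open>Sorting the products with part \<open>J\<close> by the index \<open>i\<close> of their
  label on \<open>J\<close> gives a combination of the functions \<open>g (J, i)\<close>, whose
  coefficients are themselves combinations of products over \<open>S - J\<close>, evaluated at
  \<open>y\<close>.\<close>

lemma finsum_subpartitions_containing:
  assumes ts: "tsystem n U g" and J: "J \<subseteq> S" "J \<noteq> {}"
    and x: "x \<in> box n J" and y: "y \<in> box n (S - J)" and \<alpha>: "\<alpha> \<in> UNIV \<rightarrow> carrier R"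
  shows "(\<Oplus>q\<in>{q \<in> subpartitions U {S}. J \<in> fst ` q}. \<alpha> q \<otimes> tprod g q (merge S J x y)) =
    (\<Oplus>i\<in>{i. (J, i) \<in> U}. (\<Oplus>r\<in>subpartitions U {S - J}. \<alpha> (insert (J, i) r) \<otimes> tprod g r y) \<otimes> g (J, i) x)"
proof -
  let ?I = "{i. (J, i) \<in> U}" and ?R = "subpartitions U {S - J}"
  let ?F = "\<lambda>q. \<alpha> q \<otimes> tprod g q (merge S J x y)"
  have finU: "finite U" using ts unfolding tsystem_def by auto
  have finI: "finite ?I"
    using finite_subset[OF _ finite_imageI[OF finU, of snd], of ?I] by force
  have finR: "finite ?R" using finite_subpartitions[OF finU] .
  have \<alpha>c: "\<alpha> q \<in> carrier R" for q using \<alpha> by auto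
  have z: "merge S J x y \<in> box n S"
    using x y J unfolding box_def merge_def by (auto simp: PiE_def Pi_def)
  have Fc: "?F q \<in> carrier R" if "q \<in> subpartitions U {S}" for q
    using \<alpha>c tprod_closed[OF ts that] z by simp
  have ty: "tprod g r y \<in> carrier R" if "r \<in> ?R" for r using tprod_closed[OF ts that] y by simp
  have eq: "{q \<in> subpartitions U {S}. J \<in> fst ` q} = (\<Union>i\<in>?I. insert (J, i) ` ?R)" (is "?L = ?RR")
  proof
    show "?L \<subseteq> ?RR"
    proof
      fix q assume "q \<in> ?L"
      then obtain i where q: "q \<in> subpartitions U {S}" "(J, i) \<in> q" by force
      have "q = insert (J, i) (q - {(J, i)})" using q by auto
      moreover have "q - {(J, i)} \<in> ?R" using subpartitions_remove[OF q] .
      moreover have "i \<in> ?I" using q unfolding subpartitions_def by auto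
      ultimately show "q \<in> ?RR" by blast
    qed
    show "?RR \<subseteq> ?L" using subpartitions_insert(1)[OF _ _ J] by force
  qed
  have "(\<Oplus>q\<in>?L. ?F q) = (\<Oplus>i\<in>?I. \<Oplus>q\<in>insert (J, i) ` ?R. ?F q)"
    unfolding eq
  proof (rule add.finprod_UN_disjoint[OF finI])
    \<comment> \<open>A label set contains at most one label with first component \<open>J\<close>,
      so the classes for different \<open>i\<close> are disjoint.\<close>
    have "insert (J, i) ` ?R \<inter> insert (J, j) ` ?R = {}" if "i \<in> ?I" "j \<in> ?I" "i \<noteq> j" for i j
    proof (rule ccontr)
      assume "insert (J, i) ` ?R \<inter> insert (J, j) ` ?R \<noteq> {}"
      then obtain r r' where "r \<in> ?R" "r' \<in> ?R" "insert (J, i) r = insert (J, j) r'" by auto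
      then have "(J, i) \<in> r'" using that(3) by (metis insertCI insertE prod.inject)
      then have "J \<in> fst ` r'" by force
      then show False using subpartitions_insert(2)[OF \<open>r' \<in> ?R\<close> _ J] that(2) by auto
    qed
    then show "pairwise (\<lambda>i j. disjnt (insert (J, i) ` ?R) (insert (J, j) ` ?R)) ?I"
      unfolding pairwise_def disjnt_def by blast
    show "?F q \<in> carrier R" if "i \<in> ?I" "q \<in> insert (J, i) ` ?R" for i q
      using Fc subpartitions_insert(1)[OF _ _ J] that by auto
  qed (use finR in auto)
  also have "\<dots> = (\<Oplus>i\<in>?I. (\<Oplus>r\<in>?R. \<alpha> (insert (J, i) r) \<otimes> tprod g r y) \<otimes> g (J, i) x)"
  proof (rule finsum_cong')
    fix i assume i: "i \<in> ?I"
    have inj: "inj_on (insert (J, i)) ?R"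
    proof (rule inj_onI)
      fix r r' assume r: "r \<in> ?R" "r' \<in> ?R" "insert (J, i) r = insert (J, i) r'"
      have "(J, i) \<notin> r" "(J, i) \<notin> r'"
        using subpartitions_insert(2)[OF r(1) _ J] subpartitions_insert(2)[OF r(2) _ J] i by force+
      then show "r = r'" using r(3) by (metis insert_ident)
    qed
    have gc: "g (J, i) x \<in> carrier R" using tsystem_closed[OF ts, of "(J, i)"] i x by simp
    have "(\<Oplus>q\<in>insert (J, i) ` ?R. ?F q) = (\<Oplus>r\<in>?R. ?F (insert (J, i) r))"
      using Fc subpartitions_insert(1)[OF _ _ J] i by (intro finsum_reindex[OF _ inj]) auto
    also have "\<dots> = (\<Oplus>r\<in>?R. \<alpha> (insert (J, i) r) \<otimes> tprod g r y \<otimes> g (J, i) x)"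
    proof (rule finsum_cong')
      fix r assume r: "r \<in> ?R"
      show "?F (insert (J, i) r) = \<alpha> (insert (J, i) r) \<otimes> tprod g r y \<otimes> g (J, i) x"
        using tprod_merge_insert[OF ts r J _ x y] i \<alpha>c ty[OF r] gc by (simp add: m_ac)
    qed (use \<alpha>c ty gc in auto)
    also have "\<dots> = (\<Oplus>r\<in>?R. \<alpha> (insert (J, i) r) \<otimes> tprod g r y) \<otimes> g (J, i) x"
      using finR gc \<alpha>c ty by (intro finsum_ldistr[symmetric]) auto
    finally show "(\<Oplus>q\<in>insert (J, i) ` ?R. ?F q) =
      (\<Oplus>r\<in>?R. \<alpha> (insert (J, i) r) \<otimes> tprod g r y) \<otimes> g (J, i) x" .
  next
    show "(\<lambda>i. (\<Oplus>r\<in>?R. \<alpha> (insert (J, i) r) \<otimes> tprod g r y) \<otimes> g (J, i) x) \<in> ?I \<rightarrow> carrier R"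
      using \<alpha>c ty tsystem_closed[OF ts] x by (auto intro!: finsum_closed m_closed)
  qed simp
  finally show ?thesis .
qed

text \<open>Induction on the size of \<open>S\<close>: the hypothesis for \<open>S - J\<close>
  provides values \<open>y\<close> at which the combination on \<open>J\<close> is non-trivial, and
  the threshold \<open>card (Pow U)\<close> is at least the number of remaining terms, so regularity
  is contradicted.\<close>

lemma regular_independent:
  assumes ts: "tsystem n U g" and reg: "regular n U g (card (Pow U))" 
    and "finite S" "\<alpha> \<in> UNIV \<rightarrow> carrier R"
    "\<And>x. x \<in> box n S \<Longrightarrow> (\<Oplus>q\<in>subpartitions U {S}. \<alpha> q \<otimes> tprod g q x) = \<zero>"
    and "q \<in> subpartitions U {S}"
  shows "\<alpha> q = \<zero>"
  using assms(3-6)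
proof (induction "card S" arbitrary: S \<alpha> q rule: less_induct)
  case less
  note \<alpha> = less.prems(2) and sum0 = less.prems(3)
  have \<alpha>c: "\<alpha> q \<in> carrier R" for q using \<alpha> by auto
  have finU: "finite U" using ts unfolding tsystem_def by auto
  have finS: "finite (subpartitions U {S'})" for S' using finite_subpartitions[OF finU] .
  show ?case
  proof (cases "S = {}")
    case True
    \<comment> \<open>Over no coordinates the only product is the constant one, so the sum is the
      coefficient itself.\<close>
    have sub: "subpartitions U {S} = {{}}"
      unfolding subpartitions_singleton True by (auto simp: partition_on_empty)
    have "(\<lambda>_. undefined) \<in> box n S" unfolding True box_def by simp
    from sum0[OF this] show ?thesis using less.prems(4) \<alpha>c unfolding sub by (simp add: tprod_def)
  next
    case False
    show ?thesis
    proof (rule ccontr)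
      assume nz: "\<alpha> q \<noteq> \<zero>"
      define A where "A = {q \<in> subpartitions U {S}. \<alpha> q \<noteq> \<zero>}"
      have finA: "finite A" unfolding A_def using finS by auto
      have AU: "q \<subseteq> U" if "q \<in> A" for q using that unfolding A_def subpartitions_def by auto
      have "q \<in> A" using nz less.prems(4) unfolding A_def by auto
      moreover have "fst ` q \<noteq> {}"
        using less.prems(4) False unfolding subpartitions_singleton partition_on_def by auto
      ultimately have "(\<Union>q\<in>A. fst ` q) \<noteq> {}" by auto
      moreover have "finite (\<Union>q\<in>A. fst ` q)"
        using finA AU finU by (auto intro: finite_subset)
      ultimately have ex: "\<exists>J\<in>M. \<forall>K\<in>M. card K \<le> card J" if "M = (\<Union>q\<in>A. fst ` q)" for M
        using Max_in[of "card ` M"] that Max_ge[of "card ` M"]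
        by (metis (no_types, lifting) finite_imageI imageE imageI image_is_empty)
      \<comment> \<open>\<open>J\<close> has maximal size among the parts occurring with non-zero
        coefficient, so no other such part contains it.\<close>
      obtain J where JA: "J \<in> (\<Union>q\<in>A. fst ` q)"
        and Jmax: "\<And>K. K \<in> (\<Union>q\<in>A. fst ` q) \<Longrightarrow> card K \<le> card J"
        using ex[OF refl] by blast
      from JA obtain q0 i0 where q0: "q0 \<in> A" "(J, i0) \<in> q0" by force
      have q0S: "q0 \<in> subpartitions U {S}" "\<alpha> q0 \<noteq> \<zero>" using q0 unfolding A_def by auto
      have J: "J \<subseteq> S" "J \<noteq> {}" "(J, i0) \<in> U"
        using subpartitions_part[OF q0S(1) q0(2)] q0S(1) q0(2)
        unfolding subpartitions_singleton partition_on_def by force+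
      \<comment> \<open>The coefficient of \<open>g (J, i)\<close> once the coordinates outside
        \<open>J\<close> are fixed at \<open>y\<close>.\<close>
      define G where "G y i = (\<Oplus>r\<in>subpartitions U {S - J}. \<alpha> (insert (J, i) r) \<otimes> tprod g r y)" for y i
      have "\<exists>y\<in>box n (S - J). G y i0 \<noteq> \<zero>"
      proof (rule ccontr)
        assume "\<not> ?thesis"
        \<comment> \<open>If the coefficient at \<open>i0\<close> vanished for all \<open>y\<close>,
          the induction hypothesis over \<open>S - J\<close> would kill every coefficient of a
          product containing \<open>(J, i0)\<close>, among them \<open>\<alpha> q0\<close>.\<close>
        then have "\<alpha> (insert (J, i0) (q0 - {(J, i0)})) = \<zero>"
          using less.prems(1) J unfolding G_def
          by (intro less.hyps[of "S - J" "\<lambda>r. \<alpha> (insert (J, i0) r)"])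
            (auto simp: \<alpha>c intro: psubset_card_mono subpartitions_remove[OF q0S(1) q0(2)])
        then show False using q0S(2) q0(2) by (simp add: insert_absorb)
      qed
      then obtain y where y: "y \<in> box n (S - J)" "G y i0 \<noteq> \<zero>" by auto
      have Gc: "G y i \<in> carrier R" for i
        unfolding G_def using \<alpha>c tprod_closed[OF ts] y(1) by (intro finsum_closed) auto
      define B where "B = {q \<in> A. J \<notin> fst ` q}"
      have "low_rank n J (card B) (\<lambda>x. \<Oplus>i\<in>{i. (J, i) \<in> U}. G y i \<otimes> g (J, i) x)"
      proof (rule low_rank_slices[OF ts _ J(1) y(1)])
        show BS: "B \<subseteq> subpartitions U {S}" unfolding B_def A_def by auto
        show "\<not> (\<exists>K\<in>fst ` q. J \<subseteq> K)" if "q \<in> B" for q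
        proof
          assume "\<exists>K\<in>fst ` q. J \<subseteq> K"
          then obtain K where K: "K \<in> fst ` q" "J \<subseteq> K" by auto
          have "finite K" using K(1) that AU ts unfolding B_def tsystem_def by auto
          moreover have "card K \<le> card J" using Jmax K(1) that unfolding B_def by auto
          ultimately have "K = J" using K(2) by (metis card_seteq)
          then show False using K(1) that unfolding B_def by auto
        qed
        show "(\<lambda>q. \<ominus> \<alpha> q) \<in> UNIV \<rightarrow> carrier R" using \<alpha>c by auto
        fix x assume x: "x \<in> box n J"
        let ?F = "\<lambda>q. \<alpha> q \<otimes> tprod g q (merge S J x y)"
        have z: "merge S J x y \<in> box n S"
          using x y J unfolding box_def merge_def by (auto simp: PiE_def Pi_def)
        have tc: "tprod g q (merge S J x y) \<in> carrier R" if "q \<in> subpartitions U {S}" for q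
          using tprod_closed[OF ts that] z by simp
        let ?X = "{q \<in> subpartitions U {S}. J \<in> fst ` q}"
        let ?Y = "{q \<in> subpartitions U {S}. J \<notin> fst ` q}"
        have "(\<Oplus>q\<in>?X \<union> ?Y. ?F q) = (\<Oplus>q\<in>?X. ?F q) \<oplus> (\<Oplus>q\<in>?Y. ?F q)"
          using finS tc \<alpha>c by (intro finsum_Un_disjoint) auto
        moreover have "?X \<union> ?Y = subpartitions U {S}" by auto
        moreover have "(\<Oplus>q\<in>B. ?F q) = (\<Oplus>q\<in>?Y. ?F q)"
          by (rule add.finprod_mono_neutral_cong_left) (use finS tc \<alpha>c in \<open>auto simp: B_def A_def\<close>)
        ultimately have s: "(\<Oplus>q\<in>?X. ?F q) \<oplus> (\<Oplus>q\<in>B. ?F q) = \<zero>" using sum0[OF z] by simp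
        have "(\<Oplus>q\<in>?X. ?F q) \<in> carrier R" "(\<Oplus>q\<in>B. ?F q) \<in> carrier R"
          using tc \<alpha>c BS by (auto intro!: finsum_closed)
        \<comment> \<open>The terms with part \<open>J\<close> are minus the terms of
          \<open>B\<close>; the sign moves into the coefficients, as \<open>low_rank_slices\<close>
          expects.\<close>
        then have "(\<Oplus>q\<in>?X. ?F q) = \<ominus> (\<Oplus>q\<in>B. ?F q)" using s by (simp add: minus_equality)
        also have "\<dots> = \<ominus> \<one> \<otimes> (\<Oplus>q\<in>B. ?F q)"
          using \<open>(\<Oplus>q\<in>B. ?F q) \<in> carrier R\<close> by (simp add: l_minus)
        also have "\<dots> = (\<Oplus>q\<in>B. \<ominus> \<one> \<otimes> ?F q)"
          using tc \<alpha>c BS finite_subset[OF BS finS] by (intro finsum_rdistr) auto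
        also have "\<dots> = (\<Oplus>q\<in>B. \<ominus> \<alpha> q \<otimes> tprod g q (merge S J x y))"
          using tc \<alpha>c BS by (intro finsum_cong') (auto simp: l_minus)
        finally show "(\<Oplus>i\<in>{i. (J, i) \<in> U}. G y i \<otimes> g (J, i) x) =
          (\<Oplus>q\<in>B. \<ominus> \<alpha> q \<otimes> tprod g q (merge S J x y))"
          unfolding finsum_subpartitions_containing[OF ts J(1,2) x y(1) \<alpha>] G_def .
      qed
      moreover have "card B \<le> card (Pow U)"
        using finU AU unfolding B_def by (intro card_mono) auto
      ultimately have "low_rank n J (card (Pow U)) (\<lambda>x. \<Oplus>i\<in>{i. (J, i) \<in> U}. G y i \<otimes> g (J, i) x)"
        by (rule low_rank_mono)
      then have "G y i0 = \<zero>" using reg J(3) Gc unfolding regular_def by blast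
      then show False using y(2) by simp
    qed
  qed
qed

end

section \<open>Regularisation\<close>

text \<open>Exceeds every index in use; \<open>insert 0\<close> keeps \<open>Max\<close> meaningful
  when \<open>U\<close> is empty.\<close>

definition fresh :: "label set \<Rightarrow> nat" where
  "fresh U = Suc (Max (insert 0 (snd ` U)))"

text \<open>The low-rank function that is used to eliminate the function of \<open>p\<close> has at
  most \<open>card (Pow U)\<close> terms, and a factor on \<open>K\<close> of its
  \<open>l\<close>-th term gets the label \<open>(K, fresh U + l)\<close>. Labels are supplied for
  every non-empty proper subset and every possible \<open>l\<close>, so that the result depends on
  \<open>U\<close> and \<open>p\<close> alone.\<close>

definition expand :: "label set \<Rightarrow> label \<Rightarrow> label set" where
  "expand U p = (U - {p}) \<union> {K. K \<noteq> {} \<and> K \<subset> fst p} \<times> {fresh U..<fresh U + card (Pow U)}"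

text \<open>
  Bounds the outcome of all possible runs of the replacement process started at \<open>U\<close>. It mentions
  only labels, so the bound is the same for all fields and all side lengths.
\<close>

inductive expansion_bound :: "label set \<Rightarrow> nat \<Rightarrow> bool" where
  "card (Pow U) \<le> b \<Longrightarrow> (\<And>p. p \<in> U \<Longrightarrow> expansion_bound (expand U p) b) \<Longrightarrow> expansion_bound U b"

lemma snd_less_fresh: "finite U \<Longrightarrow> p \<in> U \<Longrightarrow> snd p < fresh U"
  unfolding fresh_def by (simp add: less_Suc_eq_le)

lemma finite_proper_subsets: "finite J \<Longrightarrow> finite {K. K \<noteq> {} \<and> K \<subset> J}"
  by (rule finite_subset[of _ "Pow J"]) auto

lemma finite_expand: "finite U \<Longrightarrow> finite (fst p) \<Longrightarrow> finite (expand U p)"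
  unfolding expand_def by (simp add: finite_proper_subsets)

lemma finite_fst_expand:
  "\<forall>p\<in>U. finite (fst p) \<Longrightarrow> p \<in> U \<Longrightarrow> p' \<in> expand U p \<Longrightarrow> finite (fst p')"
  using rev_finite_subset[of "fst p" "fst p'"] unfolding expand_def by auto

lemma expansion_bound_mono: "expansion_bound U b \<Longrightarrow> b \<le> b' \<Longrightarrow> expansion_bound U b'"
  by (induction rule: expansion_bound.induct) (auto intro: expansion_bound.intros)

section \<open>Termination of the replacement process\<close>

definition label_sizes :: "label set \<Rightarrow> nat multiset" where
  "label_sizes U = image_mset (\<lambda>p. card (fst p)) (mset_set U)"

text \<open>One size is exchanged for finitely many smaller ones, a descent in the multiset order.
  Freshness keeps the new labels apart from the old ones, so the multisets add up.\<close>

lemma label_sizes_expand: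
  assumes "finite U" "p \<in> U" "finite (fst p)"
  shows "(label_sizes (expand U p), label_sizes U) \<in> mult less_than"
proof -
  let ?V = "{K. K \<noteq> {} \<and> K \<subset> fst p} \<times> {fresh U..<fresh U + card (Pow U)}"
  have fin: "finite ?V" using assms(3) by (simp add: finite_proper_subsets)
  have "(U - {p}) \<inter> ?V = {}" using snd_less_fresh[OF assms(1)] by force
  then have "label_sizes (expand U p) = label_sizes (U - {p}) + label_sizes ?V"
    unfolding label_sizes_def expand_def using assms(1) fin by (simp add: mset_set_Union)
  moreover have "label_sizes U = label_sizes (U - {p}) + {#card (fst p)#}"
    unfolding label_sizes_def using assms(1,2) by (simp add: mset_set.remove)
  moreover have "(label_sizes (U - {p}) + label_sizes ?V, label_sizes (U - {p}) + {#card (fst p)#})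
      \<in> mult less_than"
  proof (rule one_step_implies_mult)
    show "\<forall>k\<in>set_mset (label_sizes ?V). \<exists>j\<in>set_mset {#card (fst p)#}. (k, j) \<in> less_than"
      unfolding label_sizes_def using fin assms(3) by (auto simp: psubset_card_mono)
  qed simp
  ultimately show ?thesis by simp
qed

text \<open>Well-founded induction on the multiset of sizes. As \<open>U\<close> is finite there are
  finitely many choices of \<open>p\<close>, and the sum of their bounds serves all of them.\<close>

lemma expansion_bound_exists:
  assumes "finite U" "\<forall>p\<in>U. finite (fst p)"
  shows "\<exists>b. expansion_bound U b"
  using assms
proof (induction "label_sizes U" arbitrary: U rule: wf_induct_rule[OF wf_mult[OF wf_less_than]])
  case less: 1
  have "\<exists>b. expansion_bound (expand U p) b" if p: "p \<in> U" for p
  proof (rule less.hyps)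
    show "(label_sizes (expand U p), label_sizes U) \<in> mult less_than"
      using label_sizes_expand[OF less.prems(1) p] less.prems(2) p by auto
    show "finite (expand U p)" using finite_expand less.prems p by auto
    show "\<forall>p'\<in>expand U p. finite (fst p')"
      using finite_fst_expand[OF less.prems(2) p] by blast
  qed
  then obtain B where B: "\<And>p. p \<in> U \<Longrightarrow> expansion_bound (expand U p) (B p)" by metis
  define b where "b = card (Pow U) + (\<Sum>p\<in>U. B p)"
  have "expansion_bound (expand U p) b" if "p \<in> U" for p
    using expansion_bound_mono[OF B[OF that]] member_le_sum[OF that, of B] less.prems(1)
    unfolding b_def by auto
  then have "expansion_bound U b" by (rule expansion_bound.intros[rotated]) (auto simp: b_def)
  then show ?case by blast
qed

section \<open>Replacing functions until the system is regular\<close>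

context field
begin

lemma lspan_generator:
  assumes "tsystem n U g" "p \<in> U"
  shows "lspan n g (subpartitions U {fst p}) (fst p) (g p)"
proof (rule lspan_cong)
  have "fst p \<noteq> {}" using assms unfolding tsystem_def by auto
  then show "lspan n g (subpartitions U {fst p}) (fst p) (tprod g {p})"
    by (intro lspan_tprod[OF assms(1) order_refl] subpartitions_single assms) simp
  show "tprod g {p} x = g p x" if "x \<in> box n (fst p)" for x
    using tsystem_closed[OF assms that] box_restrict[OF that] by (simp add: tprod_def)
qed

text \<open>A violation of regularity equates a combination with non-zero coefficient at some
  \<open>(J, i0)\<close> to a function of low rank. Solving for \<open>g (J, i0)\<close> leaves the
  other functions on \<open>J\<close>, whose labels are kept, and products over proper subsets of
  \<open>J\<close>, whose factors become the new functions.\<close>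

lemma expand_step:
  assumes ts: "tsystem n U g" and nreg: "\<not> regular n U g (card (Pow U))"
  shows "\<exists>p\<in>U. \<exists>g'. tsystem n (expand U p) g' \<and>
    (\<forall>p'\<in>U. lspan n g' (subpartitions (expand U p) {fst p'}) (fst p') (g p'))"
proof -
  obtain J c i0 where c: "c \<in> UNIV \<rightarrow> carrier R" 
    and lr: "low_rank n J (card (Pow U)) (\<lambda>x. \<Oplus>i\<in>{i. (J, i) \<in> U}. c i \<otimes> g (J, i) x)"
    and i0: "(J, i0) \<in> U" "c i0 \<noteq> \<zero>"
    using nreg unfolding regular_def by blast
  from lr obtain m \<gamma> P b where m: "m \<le> card (Pow U)"
    and b: "\<forall>l<m. \<gamma> l \<in> carrier R \<and> partition_on J (P l) \<and> J \<notin> P l \<and>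
        (\<forall>K\<in>P l. b l K \<in> box n K \<rightarrow> carrier R)"
    and eq: "\<forall>x\<in>box n J. (\<Oplus>i\<in>{i. (J, i) \<in> U}. c i \<otimes> g (J, i) x) =
        (\<Oplus>l\<in>{..<m}. \<gamma> l \<otimes> (\<Otimes>K\<in>P l. b l K (restrict x K)))"
    unfolding low_rank_def by (elim exE conjE) (rule that)
  define s where "s = fresh U"
  define U' where "U' = expand U (J, i0)"
  \<comment> \<open>A new label \<open>(K, s + l)\<close> carries the factor on \<open>K\<close> of
    the \<open>l\<close>-th term if there is one, and the zero function otherwise.\<close>
  define g' where "g' p = (if p \<in> U then g p else
    if snd p - s < m \<and> fst p \<in> P (snd p - s) then b (snd p - s) (fst p) else (\<lambda>_. \<zero>))" for p
  have finU: "finite U" and J: "finite J" "J \<noteq> {}"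
    using ts i0(1) unfolding tsystem_def by force+
  have cc: "c i \<in> carrier R" for i using c by auto
  \<comment> \<open>New indices lie above all old ones, so the first case of \<open>g'\<close>
    cannot intercept the labels of the factors.\<close>
  have new: "(K, s + l) \<notin> U" for K l using snd_less_fresh[OF finU, of "(K, s + l)"] s_def by auto
  have ts': "tsystem n U' g'"
    unfolding tsystem_def
  proof (intro conjI ballI)
    show "finite U'" unfolding U'_def using finite_expand[OF finU] J by simp
    fix p assume p: "p \<in> U'"
    show "fst p \<noteq> {}" using p ts unfolding U'_def expand_def tsystem_def by auto
    show "finite (fst p)"
      using finite_fst_expand[OF _ i0(1) p[unfolded U'_def]] ts unfolding tsystem_def by blast
    show "g' p \<in> box n (fst p) \<rightarrow> carrier R"
      using ts b unfolding g'_def tsystem_def by auto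
  qed
  have old: "lspan n g' (subpartitions U' {fst p}) (fst p) (g p)" if "p \<in> U" "p \<noteq> (J, i0)" for p
  proof -
    have "p \<in> U'" using that unfolding U'_def expand_def by auto
    from lspan_generator[OF ts' this] show ?thesis using that by (simp add: g'_def)
  qed
  have prod: "lspan n g' (subpartitions U' {J}) J (\<lambda>x. \<Otimes>K\<in>P l. b l K (restrict x K))"
    if l: "l < m" for l
  proof (rule lspan_cong)
    let ?q = "(\<lambda>K. (K, s + l)) ` P l"
    have pt: "partition_on J (P l)" "J \<notin> P l" using b l by auto
    have im: "fst ` ?q = P l" by (force simp: image_iff)
    have "(K, s + l) \<in> U'" if "K \<in> P l" for K
    proof -
      \<comment> \<open>\<open>J \<notin> P l\<close> makes every part a proper subset, and
        \<open>l < m \<le> card (Pow U)\<close> keeps the index in the range supplied by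
        \<open>expand\<close>.\<close>
      have "K \<noteq> {}" "K \<subset> J" using pt that unfolding partition_on_def by auto
      then show ?thesis using l m unfolding U'_def expand_def s_def by simp
    qed
    then have q: "?q \<in> subpartitions U' {J}"
      unfolding subpartitions_singleton using pt(1) by (auto simp: inj_on_def image_image)
    show "lspan n g' (subpartitions U' {J}) J (tprod g' ?q)"
      by (rule lspan_tprod[OF ts' order_refl _ q]) simp
    fix x assume x: "x \<in> box n J"
    have g'b: "g' (K, s + l) = b l K" if "K \<in> P l" for K
      using new l that unfolding g'_def by simp
    have bc: "b l K (restrict x K) \<in> carrier R" if "K \<in> P l" for K
    proof -
      have "K \<subseteq> J" using pt that unfolding partition_on_def by auto
      from restrict_in_box[OF x this] show ?thesis using b l that by blast
    qed
    have "tprod g' ?q x = (\<Otimes>K\<in>P l. g' (K, s + l) (restrict x K))"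
      unfolding tprod_def
      by (subst finprod_reindex) (use g'b bc in \<open>auto simp: inj_on_def\<close>)
    also have "\<dots> = (\<Otimes>K\<in>P l. b l K (restrict x K))"
      by (rule finprod_cong') (use g'b bc in auto)
    finally show "tprod g' ?q x = (\<Otimes>K\<in>P l. b l K (restrict x K))" .
  qed
  let ?I = "{i. (J, i) \<in> U}"
  have finI: "finite ?I"
    using finite_subset[OF _ finite_imageI[OF finU, of snd], of ?I] by force
  \<comment> \<open>The identity solved for \<open>g (J, i0)\<close>, with subtraction written as
    the scalar \<open>\<ominus> \<one>\<close> so that the closure rules of the span apply.\<close>
  let ?f = "\<lambda>x. inv c i0 \<otimes> ((\<Oplus>l\<in>{..<m}. \<gamma> l \<otimes> (\<Otimes>K\<in>P l. b l K (restrict x K))) \<oplus>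
    \<ominus> \<one> \<otimes> (\<Oplus>i\<in>?I - {i0}. c i \<otimes> g (J, i) x))"
  have c0: "c i0 \<in> Units R" using cc i0(2) field_Units by auto
  have ts3: "J = \<Union>{J}" by simp
  have "lspan n g' (subpartitions U' {J}) J ?f"
  proof (intro lspan_scale[OF ts' order_refl ts3] lspan_add[OF ts' order_refl ts3]
      lspan_finsum[OF ts' order_refl ts3])
    show "inv c i0 \<in> carrier R" using c0 by simp
    show "\<gamma> l \<in> carrier R" if "l \<in> {..<m}" for l using that b by simp
    show "lspan n g' (subpartitions U' {J}) J (\<lambda>x. \<Otimes>K\<in>P l. b l K (restrict x K))"
      if "l \<in> {..<m}" for l using prod that by simp
    show "lspan n g' (subpartitions U' {J}) J (g (J, i))" if "i \<in> ?I - {i0}" for i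
      using old[of "(J, i)"] that by simp
  qed (use cc finI in auto)
  then have "lspan n g' (subpartitions U' {J}) J (g (J, i0))"
  proof (rule lspan_cong)
    fix x assume x: "x \<in> box n J"
    have gc: "g (J, i) x \<in> carrier R" if "i \<in> ?I" for i
      using tsystem_closed[OF ts, of "(J, i)"] that x by simp
    have rc: "(\<Oplus>i\<in>?I - {i0}. c i \<otimes> g (J, i) x) \<in> carrier R"
      using gc cc by (intro finsum_closed) auto
    have "(\<Oplus>i\<in>insert i0 (?I - {i0}). c i \<otimes> g (J, i) x) =
       c i0 \<otimes> g (J, i0) x \<oplus> (\<Oplus>i\<in>?I - {i0}. c i \<otimes> g (J, i) x)"
      using finI gc cc i0 by (intro finsum_insert) auto
    moreover have "insert i0 (?I - {i0}) = ?I" using i0(1) by auto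
    ultimately have "(\<Oplus>l\<in>{..<m}. \<gamma> l \<otimes> (\<Otimes>K\<in>P l. b l K (restrict x K))) =
       c i0 \<otimes> g (J, i0) x \<oplus> (\<Oplus>i\<in>?I - {i0}. c i \<otimes> g (J, i) x)"
      using eq x by simp
    then have "?f x = inv c i0 \<otimes> (c i0 \<otimes> g (J, i0) x \<oplus> (\<Oplus>i\<in>?I - {i0}. c i \<otimes> g (J, i) x) \<oplus>
       \<ominus> (\<Oplus>i\<in>?I - {i0}. c i \<otimes> g (J, i) x))"
      using rc by (simp add: l_minus)
    also have "\<dots> = inv c i0 \<otimes> (c i0 \<otimes> g (J, i0) x)"
      using rc cc gc[of i0] i0(1) by (simp add: a_assoc r_neg)
    also have "\<dots> = g (J, i0) x"
      using c0 cc gc[of i0] i0(1) by (simp add: m_assoc[symmetric])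
    finally show "?f x = g (J, i0) x" .
  qed
  then have "\<forall>p'\<in>U. lspan n g' (subpartitions U' {fst p'}) (fst p') (g p')"
    using old by (metis fst_conv)
  then show ?thesis using ts' i0(1) unfolding U'_def by blast
qed

text \<open>Induction along \<open>expansion_bound\<close>, which mirrors the process: its first
  premise bounds the size if the process stops at \<open>U\<close>, its second covers every possible
  next step. Expansions over successive systems are composed by \<open>lspan_subst\<close>.\<close>

lemma regularise:
  assumes "expansion_bound U b" "tsystem n U g"
  shows "\<exists>U' g'. tsystem n U' g' \<and> regular n U' g' (card (Pow U')) \<and> card (Pow U') \<le> b \<and>
    (\<forall>p\<in>U. lspan n g' (subpartitions U' {fst p}) (fst p) (g p))"
  using assms
proof (induction arbitrary: g rule: expansion_bound.induct)
  case (1 U b)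
  show ?case
  proof (cases "regular n U g (card (Pow U))")
    case True
    then show ?thesis using 1 lspan_generator by blast
  next
    case False
    obtain p g1 where p: "p \<in> U" and ts1: "tsystem n (expand U p) g1"
      and l1: "\<forall>p'\<in>U. lspan n g1 (subpartitions (expand U p) {fst p'}) (fst p') (g p')"
      using expand_step[OF 1(4) False] by blast
    obtain U' g' where U': "tsystem n U' g'" "regular n U' g' (card (Pow U'))" "card (Pow U') \<le> b"
      and l2: "\<forall>p'\<in>expand U p. lspan n g' (subpartitions U' {fst p'}) (fst p') (g1 p')"
      using 1(3)[OF p ts1] by blast
    have "lspan n g' (subpartitions U' {fst p'}) (fst p') (g p')" if "p' \<in> U" for p'
    proof -
      have "lspan n g' (subpartitions U' {fst p'}) (\<Union>{fst p'}) (g p')"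
      proof (rule lspan_subst[OF U'(1)])
        show "finite (expand U p)" using ts1 unfolding tsystem_def by simp
      qed (use l1 l2 that in auto)
      then show ?thesis by simp
    qed
    then show ?thesis using U' by blast
  qed
qed

end

section \<open>Rank decompositions\<close>

text \<open>The predicate whose least solution is \<open>R_rank\<close>, named so that
  decompositions can be manipulated and moved between fields before minimality is invoked.\<close>

definition rank_decomposable ::
  "('a, 'm) ring_scheme \<Rightarrow> nat \<Rightarrow> (nat \<Rightarrow> nat) \<Rightarrow> nat set set set \<Rightarrow> ((nat \<Rightarrow> nat) \<Rightarrow> 'a) \<Rightarrow> nat \<Rightarrow> bool"
  where "rank_decomposable F d n \<R> T k \<longleftrightarrow>
     (\<exists>Ts. (\<forall>i<k. tensor F d n (Ts i) \<and> R_rank_le_one F d n \<R> (Ts i)) \<and>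
        (\<forall>x\<in>box n {1..d}. T x = (\<Oplus>\<^bsub>F\<^esub>i\<in>{..<k}. Ts i x)))"

lemma R_rank_le: "rank_decomposable F d n \<R> T k \<Longrightarrow> R_rank F d n \<R> T \<le> k"
  unfolding R_rank_def rank_decomposable_def by (rule Least_le)

section \<open>Common refinements\<close>

lemma partition_on_refine:
  assumes "partition_on S P1" "partition_on S P2"
  shows "partition_on S (refine P1 P2)"
proof (rule partition_onI)
  show "\<Union>(refine P1 P2) = S"
    using assms unfolding refine_def partition_on_def by blast
  show "{} \<notin> refine P1 P2" unfolding refine_def by auto
  fix K L assume KL: "K \<in> refine P1 P2" "L \<in> refine P1 P2" "K \<noteq> L"
  obtain K1 K2 L1 L2 where *: "K = K1 \<inter> K2" "L = L1 \<inter> L2" "K1 \<in> P1" "L1 \<in> P1" "K2 \<in> P2" "L2 \<in> P2"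
    using KL unfolding refine_def by blast
  then have "K1 \<noteq> L1 \<or> K2 \<noteq> L2" using KL(3) by auto
  then have "K1 \<inter> L1 = {} \<or> K2 \<inter> L2 = {}"
    using * disjointD[OF partition_onD2[OF assms(1)]] disjointD[OF partition_onD2[OF assms(2)]]
    by metis
  then show "disjnt K L" using * unfolding disjnt_def by auto
qed

lemma partition_family_refine:
  assumes "partition_family d R1" "partition_family d R2"
  shows "partition_family d (refine_family R1 R2)"
  using assms partition_on_refine unfolding partition_family_def refine_family_def by blast

lemma subpartitions_refine:
  assumes "partition_on S P1" "partition_on S P2"
    "q \<in> subpartitions U P1" "q \<in> subpartitions U P2"
  shows "q \<in> subpartitions U (refine P1 P2)"
proof -
  have un: "\<Union>P1 = S" "\<Union>(refine P1 P2) = S"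
    using assms(1) partition_on_refine[OF assms(1,2)] unfolding partition_on_def by auto
  have cov: "\<forall>A\<in>fst ` q. \<exists>B\<in>P1. A \<subseteq> B" "\<forall>A\<in>fst ` q. \<exists>B\<in>P2. A \<subseteq> B"
    using assms(3,4) unfolding subpartitions_def by simp_all
  have "\<exists>B\<in>refine P1 P2. A \<subseteq> B" if A: "A \<in> fst ` q" for A
  proof -
    obtain B1 where "B1 \<in> P1" "A \<subseteq> B1"
      using cov(1) A by blast
    moreover obtain B2 where "B2 \<in> P2" "A \<subseteq> B2"
      using cov(2) A by blast
    moreover have "A \<noteq> {}" using assms(3) A unfolding subpartitions_def partition_on_def by auto
    ultimately have "B1 \<inter> B2 \<in> refine P1 P2" "A \<subseteq> B1 \<inter> B2" unfolding refine_def by blast+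
    then show ?thesis by blast
  qed
  then show ?thesis using assms(3) un unfolding subpartitions_def by auto
qed

section \<open>Decompositions over a fixed field\<close>

context field
begin

lemma R_rank_le_one_closed:
  assumes "partition_family d \<R>" "R_rank_le_one R d n \<R> t"
  shows "tensor R d n t"
proof -
  obtain P a where P: "P \<in> \<R>" and a: "\<forall>J\<in>P. a J \<in> box n J \<rightarrow> carrier R"
    and t: "\<forall>x\<in>box n {1..d}. t x = (\<Otimes>J\<in>P. a J (restrict x J))"
    using assms(2) unfolding R_rank_le_one_def by blast
  have "t x \<in> carrier R" if x: "x \<in> box n {1..d}" for x
  proof -
    have "a J (restrict x J) \<in> carrier R" if "J \<in> P" for J
    proof -
      have "J \<subseteq> {1..d}" using assms(1) P that unfolding partition_family_def partition_on_def by blast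
      from restrict_in_box[OF x this] show ?thesis using a that by blast
    qed
    then show ?thesis using t x by (simp add: finprod_closed)
  qed
  then show ?thesis unfolding tensor_def by blast
qed

text \<open>Reindexing by an initial segment allows sums over multi-indices or over label sets to
  serve as decompositions.\<close>

lemma rank_decomposable_finsum:
  assumes \<R>: "partition_family d \<R>" and fin: "finite I"
    and t: "\<And>i. i \<in> I \<Longrightarrow> R_rank_le_one R d n \<R> (t i)"
    and T: "\<And>x. x \<in> box n {1..d} \<Longrightarrow> T x = (\<Oplus>i\<in>I. t i x)"
  shows "rank_decomposable R d n \<R> T (card I)"
proof -
  obtain h where h: "bij_betw h {0..<card I} I" using ex_bij_betw_nat_finite[OF fin] by auto
  have hI: "h l \<in> I" if "l < card I" for l using h that by (auto simp: bij_betw_def)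
  have tc: "t i x \<in> carrier R" if "i \<in> I" "x \<in> box n {1..d}" for i x
    using R_rank_le_one_closed[OF \<R> t[OF that(1)]] that(2) unfolding tensor_def by blast
  show ?thesis
    unfolding rank_decomposable_def
  proof (intro exI[of _ "\<lambda>l. t (h l)"] conjI allI impI ballI)
    fix x assume x: "x \<in> box n {1..d}"
    have "(\<Oplus>i\<in>h ` {..<card I}. t i x) = (\<Oplus>l\<in>{..<card I}. t (h l) x)"
      by (rule finsum_reindex) (use h tc hI x in \<open>auto simp: bij_betw_def lessThan_atLeast0\<close>)
    moreover have "h ` {..<card I} = I" using h by (simp add: bij_betw_def lessThan_atLeast0)
    ultimately show "T x = (\<Oplus>l\<in>{..<card I}. t (h l) x)" using T[OF x] by simp
  qed (use t hI R_rank_le_one_closed[OF \<R>] in auto)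
qed

text \<open>The scalar is absorbed into one factor; \<open>d \<ge> 1\<close> guarantees that the
  partition has a part to carry it.\<close>

lemma R_rank_le_one_scale:
  assumes \<R>: "partition_family d \<R>" and d: "d \<ge> 1" and c: "c \<in> carrier R"
    and t: "R_rank_le_one R d n \<R> t"
  shows "R_rank_le_one R d n \<R> (\<lambda>x. c \<otimes> t x)"
proof -
  obtain P a where P: "P \<in> \<R>" and a: "\<forall>J\<in>P. a J \<in> box n J \<rightarrow> carrier R"
    and t: "\<forall>x\<in>box n {1..d}. t x = (\<Otimes>J\<in>P. a J (restrict x J))"
    using t unfolding R_rank_le_one_def by blast
  have part: "partition_on {1..d} P" using \<R> P unfolding partition_family_def by blast
  have fin: "finite P" using finite_elements[OF _ part] by simp
  obtain J0 where J0: "J0 \<in> P" using part d unfolding partition_on_def by fastforce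
  define a' where "a' J z = (if J = J0 then c \<otimes> a J z else a J z)" for J z
  have "c \<otimes> t x = (\<Otimes>J\<in>P. a' J (restrict x J))" if x: "x \<in> box n {1..d}" for x
  proof -
    have ac: "a J (restrict x J) \<in> carrier R" if "J \<in> P" for J
    proof -
      have "J \<subseteq> {1..d}" using part that unfolding partition_on_def by blast
      from restrict_in_box[OF x this] show ?thesis using a that by blast
    qed
    have P_eq: "P = insert J0 (P - {J0})" using J0 by auto
    have "(\<Otimes>J\<in>insert J0 (P - {J0}). a J (restrict x J)) =
        a J0 (restrict x J0) \<otimes> (\<Otimes>J\<in>P - {J0}. a J (restrict x J))"
      by (rule finprod_insert) (use fin ac J0 in auto)
    moreover have "(\<Otimes>J\<in>insert J0 (P - {J0}). a' J (restrict x J)) =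
        a' J0 (restrict x J0) \<otimes> (\<Otimes>J\<in>P - {J0}. a' J (restrict x J))"
      by (rule finprod_insert) (use fin ac J0 c in \<open>auto simp: a'_def\<close>)
    moreover have "(\<Otimes>J\<in>P - {J0}. a' J (restrict x J)) = (\<Otimes>J\<in>P - {J0}. a J (restrict x J))"
      by (rule finprod_cong') (use ac in \<open>auto simp: a'_def\<close>)
    moreover have "(\<Otimes>J\<in>P - {J0}. a J (restrict x J)) \<in> carrier R"
      by (rule finprod_closed) (use ac in auto)
    ultimately show ?thesis
      using t x P_eq c ac[OF J0] by (simp add: a'_def m_assoc)
  qed
  moreover have "\<forall>J\<in>P. a' J \<in> box n J \<rightarrow> carrier R"
  proof (intro ballI Pi_I)
    fix J z assume "J \<in> P" "z \<in> box n J"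
    then have "a J z \<in> carrier R" using a by blast
    then show "a' J z \<in> carrier R" using c unfolding a'_def by auto
  qed
  ultimately show ?thesis unfolding R_rank_le_one_def using P by blast
qed

text \<open>Every tensor is a combination of point masses. A point mass factors along any partition,
  since a multi-index is determined by its restrictions to the parts. Hence the minimum in
  \<open>R_rank\<close> is attained.\<close>

lemma rank_decomposable_exists:
  assumes \<R>: "partition_family d \<R>" and d: "d \<ge> 1" and T: "tensor R d n T"
  shows "\<exists>k. rank_decomposable R d n \<R> T k"
proof -
  obtain P where P: "P \<in> \<R>" using \<R> unfolding partition_family_def by auto
  have part: "partition_on {1..d} P" using \<R> P unfolding partition_family_def by blast
  have fin: "finite P" using finite_elements[OF _ part] by simp
  let ?\<delta> = "\<lambda>z x. if x = z then \<one> else \<zero>"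
  let ?B = "box n {1..d}"
  have Tc: "T z \<in> carrier R" if "z \<in> ?B" for z using T that unfolding tensor_def by auto
  have "R_rank_le_one R d n \<R> (?\<delta> z)" if z: "z \<in> ?B" for z
    unfolding R_rank_le_one_def
  proof (intro bexI[OF _ P] exI[of _ "\<lambda>J y. if y = restrict z J then \<one> else \<zero>"] conjI ballI)
    fix x assume x: "x \<in> ?B"
    show "?\<delta> z x = (\<Otimes>J\<in>P. if restrict x J = restrict z J then \<one> else \<zero>)"
    proof (cases "x = z")
      case True then show ?thesis by simp
    next
      case False
      have "\<exists>J\<in>P. restrict x J \<noteq> restrict z J"
      proof (rule ccontr)
        assume "\<not> ?thesis"
        then have "x j = z j" if "j \<in> {1..d}" for j
          using part that unfolding partition_on_def by (metis UnionE restrict_apply')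
        then have "x = z" using x z unfolding box_def by (metis PiE_ext)
        then show False using False by simp
      qed
      then obtain J where J: "J \<in> P" "restrict x J \<noteq> restrict z J" by auto
      have "(\<Otimes>J\<in>insert J (P - {J}). if restrict x J = restrict z J then \<one> else \<zero>) = 
         (if restrict x J = restrict z J then \<one> else \<zero>) \<otimes>
         (\<Otimes>J\<in>P - {J}. if restrict x J = restrict z J then \<one> else \<zero>)"
        by (rule finprod_insert) (use fin in auto)
      then show ?thesis using J False by (simp add: insert_absorb)
    qed
  qed auto
  then have "rank_decomposable R d n \<R> T (card ?B)"
  proof (intro rank_decomposable_finsum[OF \<R>, where t = "\<lambda>z x. T z \<otimes> ?\<delta> z x"])
    show "R_rank_le_one R d n \<R> (\<lambda>x. T z \<otimes> ?\<delta> z x)"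
      if "\<And>z. z \<in> ?B \<Longrightarrow> R_rank_le_one R d n \<R> (?\<delta> z)" "z \<in> ?B" for z
      by (rule R_rank_le_one_scale[OF \<R> d Tc[OF that(2)] that(1)[OF that(2)]])
    fix x assume x: "x \<in> ?B"
    have "(\<Oplus>z\<in>?B. T z \<otimes> ?\<delta> z x) = (\<Oplus>z\<in>?B. if x = z then T z else \<zero>)"
      by (rule finsum_cong') (use Tc in auto)
    also have "\<dots> = T x"
      by (rule finsum_singleton) (use x Tc finite_box[of "{1..d}" n] in auto)
    finally show "T x = (\<Oplus>z\<in>?B. T z \<otimes> ?\<delta> z x)" by simp
  qed (simp add: finite_box)
  then show ?thesis by blast
qed

lemma rank_decomposable_R_rank:
  assumes "partition_family d \<R>" "d \<ge> 1" "tensor R d n T"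
  shows "rank_decomposable R d n \<R> T (R_rank R d n \<R> T)"
  using rank_decomposable_exists[OF assms] unfolding R_rank_def rank_decomposable_def
  by (rule LeastI_ex)

text \<open>Grouping the labels of \<open>q\<close> by the part of \<open>P\<close> that contains
  them gives one factor for each part; the groups are disjoint because the coordinate sets of labels
  are non-empty.\<close>

lemma R_rank_le_one_tprod:
  assumes \<R>: "partition_family d \<R>" and P: "P \<in> \<R>" and ts: "tsystem n U g"
    and q: "q \<in> subpartitions U P"
  shows "R_rank_le_one R d n \<R> (tprod g q)"
proof -
  have part: "partition_on {1..d} P" using \<R> P unfolding partition_family_def by blast
  have fin: "finite P" using finite_elements[OF _ part] by simp
  have qU: "q \<subseteq> U" and finq: "finite q" and ref: "\<forall>A\<in>fst ` q. \<exists>B\<in>P. A \<subseteq> B"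
    using q ts unfolding subpartitions_def tsystem_def by (auto intro: finite_subset)
  let ?q = "\<lambda>L. {p \<in> q. fst p \<subseteq> L}"
  define a where "a L = tprod g (?q L)" for L
  have gc: "g p (restrict x (fst p)) \<in> carrier R" if "p \<in> q" "fst p \<subseteq> L" "x \<in> box n L" for p L x
    using tsystem_closed[OF ts subsetD[OF qU that(1)] restrict_in_box[OF that(3,2)]] .
  have ac: "a L z \<in> carrier R" if "z \<in> box n L" for L z
    unfolding a_def tprod_def using gc that by (auto intro!: finprod_closed)
  have q_eq: "q = (\<Union>L\<in>P. ?q L)" using ref by auto
  have disj: "pairwise (\<lambda>K L. disjnt (?q K) (?q L)) P"
  proof (intro pairwiseI)
    fix K L assume KL: "K \<in> P" "L \<in> P" "K \<noteq> L"
    then have "K \<inter> L = {}" using disjointD[OF partition_onD2[OF part]] by auto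
    then show "disjnt (?q K) (?q L)" using qU ts unfolding disjnt_def tsystem_def by blast
  qed
  show ?thesis
    unfolding R_rank_le_one_def
  proof (intro bexI[OF _ P] exI[of _ a] conjI ballI)
    show "a L \<in> box n L \<rightarrow> carrier R" if "L \<in> P" for L
      using ac by blast
    fix x assume x: "x \<in> box n {1..d}"
    have gx: "g p (restrict x (fst p)) \<in> carrier R" if "p \<in> q" for p
      using gc[OF that _ x] subpartitions_part[OF q that] part unfolding partition_on_def by auto
    have "tprod g q x = (\<Otimes>L\<in>P. tprod g (?q L) x)"
      unfolding tprod_def
      by (subst q_eq, rule finprod_UN_disjoint[OF fin _ disj]) (use finq gx in auto)
    also have "\<dots> = (\<Otimes>L\<in>P. a L (restrict x L))"
    proof (rule finprod_cong')
      fix L assume L: "L \<in> P"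
      show "tprod g (?q L) x = a L (restrict x L)"
        unfolding a_def tprod_def
      proof (rule finprod_cong')
        show "g p (restrict x (fst p)) = g p (restrict (restrict x L) (fst p))" if "p \<in> ?q L" for p
          using that restrict_restrict_subset[of "fst p" L x] by simp
        show "(\<lambda>p. g p (restrict (restrict x L) (fst p))) \<in> ?q L \<rightarrow> carrier R"
        proof
          fix p assume p: "p \<in> ?q L"
          have "restrict (restrict x L) (fst p) = restrict x (fst p)"
            using p by (intro restrict_restrict_subset) auto
          then show "g p (restrict (restrict x L) (fst p)) \<in> carrier R" using gx p by simp
        qed
      qed simp
    next
      show "(\<lambda>L. a L (restrict x L)) \<in> P \<rightarrow> carrier R"
      proof
        fix L assume L: "L \<in> P"
        have "restrict x L \<in> box n L"
          using L part by (intro restrict_in_box[OF x]) (auto simp: partition_on_def)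
        then show "a L (restrict x L) \<in> carrier R" by (rule ac)
      qed
    qed simp
    finally show "tprod g q x = (\<Otimes>L\<in>P. a L (restrict x L))" .
  qed
qed

section \<open>Combining two expansions of the same tensor\<close>

lemma subpartitions_partition:
  "partition_on S P \<Longrightarrow> subpartitions U P \<subseteq> subpartitions U {S}"
  by (rule subpartitions_mono) (auto simp: partition_on_def)

text \<open>Expanding every factor in \<open>g\<close> and multiplying out turns the term along
  \<open>P i\<close> into products whose label sets refine \<open>P i\<close>.\<close>

lemma lspan_rank_sum:
  fixes k :: nat
  assumes ts: "tsystem n U g" and \<R>: "partition_family d \<R>"
    and P: "\<And>i. i < k \<Longrightarrow> P i \<in> \<R>"
    and a: "\<And>i J. i < k \<Longrightarrow> J \<in> P i \<Longrightarrow> lspan n g (subpartitions U {J}) J (a i J)"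
    and T: "\<And>x. x \<in> box n {1..d} \<Longrightarrow> T x = (\<Oplus>i\<in>{..<k}. \<Otimes>J\<in>P i. a i J (restrict x J))"
  shows "lspan n g (\<Union>P\<in>\<R>. subpartitions U P) {1..d} T"
proof -
  let ?Q = "\<Union>P\<in>\<R>. subpartitions U P"
  have part: "partition_on {1..d} P" if "P \<in> \<R>" for P using \<R> that unfolding partition_family_def by blast
  have Q: "?Q \<subseteq> subpartitions U {{1..d}}" using subpartitions_partition[OF part] by blast
  have "lspan n g ?Q {1..d} (\<lambda>x. \<Otimes>J\<in>P i. a i J (restrict x J))" if i: "i < k" for i
  proof (rule lspan_mono)
    have pi: "partition_on {1..d} (P i)" using part[OF P[OF i]] .
    have "lspan n g (subpartitions U ((\<lambda>J. J) ` P i)) (\<Union>((\<lambda>J. J) ` P i)) (\<lambda>x. \<Otimes>J\<in>P i. a i J (restrict x J))"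
    proof (rule lspan_finprod[OF ts])
      show "finite (P i)" using finite_elements[OF _ pi] by simp
      show "disjoint_family_on (\<lambda>J. J) (P i)"
        using pi unfolding partition_on_def disjoint_family_on_def disjoint_def by auto
    qed (rule a[OF i])
    then show "lspan n g (subpartitions U (P i)) {1..d} (\<lambda>x. \<Otimes>J\<in>P i. a i J (restrict x J))"
      using pi unfolding partition_on_def by simp
    show "subpartitions U (P i) \<subseteq> ?Q" using P[OF i] by auto
  qed
  then have "lspan n g ?Q {1..d} (\<lambda>x. \<Oplus>i\<in>{..<k}. \<Otimes>J\<in>P i. a i J (restrict x J))"
    by (intro lspan_finsum[OF ts Q]) auto
  then show ?thesis by (rule lspan_cong) (use T in simp)
qed

text \<open>The products indexed by \<open>?I\<close> are independent by regularity, so the two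
  coefficient functions agree. A surviving label set refines a member of \<open>R1\<close> and a
  member of \<open>R2\<close>, hence their common refinement.\<close>

lemma rank_decomposable_refine:
  assumes ts: "tsystem n U g" and reg: "regular n U g (card (Pow U))"
    and R1: "partition_family d R1" and R2: "partition_family d R2" and d: "d \<ge> 1"
    and l1: "lspan n g (\<Union>P\<in>R1. subpartitions U P) {1..d} T"
    and l2: "lspan n g (\<Union>P\<in>R2. subpartitions U P) {1..d} T"
  shows "\<exists>k\<le>card (Pow U). rank_decomposable R d n (refine_family R1 R2) T k"
proof -
  let ?S = "{1..d}"
  let ?Q1 = "\<Union>P\<in>R1. subpartitions U P" and ?Q2 = "\<Union>P\<in>R2. subpartitions U P"
  let ?I = "subpartitions U {?S}"
  have part1: "partition_on ?S P" if "P \<in> R1" for P using R1 that unfolding partition_family_def by blast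
  have part2: "partition_on ?S P" if "P \<in> R2" for P using R2 that unfolding partition_family_def by blast
  have Q1: "?Q1 \<subseteq> ?I" using subpartitions_partition[OF part1] by blast
  have Q2: "?Q2 \<subseteq> ?I" using subpartitions_partition[OF part2] by blast
  have finU: "finite U" using ts unfolding tsystem_def by auto
  have finI: "finite ?I" using finite_subpartitions[OF finU] .
  obtain \<alpha> where \<alpha>: "\<alpha> \<in> (UNIV :: label set set) \<rightarrow> carrier R" "\<forall>q. q \<notin> ?Q1 \<longrightarrow> \<alpha> q = \<zero>"
    "\<forall>x\<in>box n ?S. T x = (\<Oplus>q\<in>?I. \<alpha> q \<otimes> tprod g q x)"
    using lspan_coeffs[OF ts Q1 _ l1] by auto
  obtain \<beta> where \<beta>: "\<beta> \<in> (UNIV :: label set set) \<rightarrow> carrier R" "\<forall>q. q \<notin> ?Q2 \<longrightarrow> \<beta> q = \<zero>"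
    "\<forall>x\<in>box n ?S. T x = (\<Oplus>q\<in>?I. \<beta> q \<otimes> tprod g q x)"
    using lspan_coeffs[OF ts Q2 _ l2] by auto
  have \<alpha>c: "\<alpha> q \<in> carrier R" and \<beta>c: "\<beta> q \<in> carrier R" for q using \<alpha>(1) \<beta>(1) by auto
  have tc: "tprod g q x \<in> carrier R" if "q \<in> ?I" "x \<in> box n ?S" for q x
    using tprod_closed[OF ts that(1)] that(2) by simp
  have eq: "\<alpha> q = \<beta> q" if q: "q \<in> ?I" for q
  proof -
    have "\<alpha> q \<ominus> \<beta> q = \<zero>"
    proof (rule regular_independent[OF ts reg _ _ _ q])
      show "(\<lambda>q. \<alpha> q \<ominus> \<beta> q) \<in> UNIV \<rightarrow> carrier R" using \<alpha>c \<beta>c by auto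
      fix x assume x: "x \<in> box n ?S"
      \<comment> \<open>Adding the sum for \<open>\<beta>\<close> to the difference gives the sum
        for \<open>\<alpha>\<close>; both sums equal \<open>T x\<close>, which then cancels.\<close>
      have "(\<Oplus>q\<in>?I. (\<alpha> q \<ominus> \<beta> q) \<otimes> tprod g q x) \<oplus> (\<Oplus>q\<in>?I. \<beta> q \<otimes> tprod g q x) =
        (\<Oplus>q\<in>?I. (\<alpha> q \<ominus> \<beta> q) \<otimes> tprod g q x \<oplus> \<beta> q \<otimes> tprod g q x)"
        by (rule finsum_addf[symmetric]) (use \<alpha>c \<beta>c tc x in auto)
      also have "\<dots> = (\<Oplus>q\<in>?I. \<alpha> q \<otimes> tprod g q x)"
      proof (rule finsum_cong')
        fix q assume q: "q \<in> ?I"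
        have "(\<alpha> q \<ominus> \<beta> q) \<otimes> tprod g q x \<oplus> \<beta> q \<otimes> tprod g q x = (\<alpha> q \<ominus> \<beta> q \<oplus> \<beta> q) \<otimes> tprod g q x"
          using \<alpha>c \<beta>c tc[OF q x] by (simp add: l_distr)
        also have "\<alpha> q \<ominus> \<beta> q \<oplus> \<beta> q = \<alpha> q"
          using \<alpha>c \<beta>c by (simp add: minus_eq a_assoc l_neg)
        finally show "(\<alpha> q \<ominus> \<beta> q) \<otimes> tprod g q x \<oplus> \<beta> q \<otimes> tprod g q x = \<alpha> q \<otimes> tprod g q x" .
      qed (use \<alpha>c tc x in auto)
      finally have "(\<Oplus>q\<in>?I. (\<alpha> q \<ominus> \<beta> q) \<otimes> tprod g q x) \<oplus> T x = \<zero> \<oplus> T x"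
        using \<alpha>(3) \<beta>(3) x tc \<alpha>c by (simp add: finsum_closed)
      moreover have "T x \<in> carrier R" using \<alpha>(3) x tc \<alpha>c by (auto intro!: finsum_closed)
      moreover have "(\<Oplus>q\<in>?I. (\<alpha> q \<ominus> \<beta> q) \<otimes> tprod g q x) \<in> carrier R"
        using x tc \<alpha>c \<beta>c by (auto intro!: finsum_closed)
      ultimately show "(\<Oplus>q\<in>?I. (\<alpha> q \<ominus> \<beta> q) \<otimes> tprod g q x) = \<zero>"
        by (metis add.right_cancel zero_closed)
    qed simp
    then show ?thesis using \<alpha>c \<beta>c by simp
  qed
  let ?Q = "?Q1 \<inter> ?Q2"
  have QI: "?Q \<subseteq> ?I" using Q1 by auto
  note R12 = partition_family_refine[OF R1 R2]
  have "rank_decomposable R d n (refine_family R1 R2) T (card ?Q)"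
  proof (rule rank_decomposable_finsum[OF R12, where t = "\<lambda>q x. \<alpha> q \<otimes> tprod g q x"])
    show "finite ?Q" using finite_subset[OF QI finI] .
    show "R_rank_le_one R d n (refine_family R1 R2) (\<lambda>x. \<alpha> q \<otimes> tprod g q x)" if q: "q \<in> ?Q" for q
    proof -
      obtain P1 P2 where P: "P1 \<in> R1" "P2 \<in> R2" "q \<in> subpartitions U P1" "q \<in> subpartitions U P2"
        using q by blast
      have "q \<in> subpartitions U (refine P1 P2)"
        using subpartitions_refine[OF part1[OF P(1)] part2[OF P(2)] P(3,4)] .
      moreover have "refine P1 P2 \<in> refine_family R1 R2" using P unfolding refine_family_def by blast
      ultimately show ?thesis
        by (intro R_rank_le_one_scale[OF R12 d \<alpha>c] R_rank_le_one_tprod[OF R12 _ ts])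
    qed
    fix x assume x: "x \<in> box n ?S"
    have "(\<Oplus>q\<in>?Q. \<alpha> q \<otimes> tprod g q x) = (\<Oplus>q\<in>?I. \<alpha> q \<otimes> tprod g q x)"
    proof (rule add.finprod_mono_neutral_cong_left[OF finI QI])
      fix q assume q: "q \<in> ?I - ?Q"
      \<comment> \<open>Outside \<open>?Q\<close> one of the two equal coefficients is zero.\<close>
      then have "\<alpha> q = \<zero>" using \<alpha>(2) \<beta>(2) eq[of q] by auto
      then show "\<alpha> q \<otimes> tprod g q x = \<zero>" using tc x q by simp
    qed (use \<alpha>c tc x in auto)
    then show "T x = (\<Oplus>q\<in>?Q. \<alpha> q \<otimes> tprod g q x)" using \<alpha>(3) x by simp
  qed
  moreover have "card ?Q \<le> card (Pow U)"
    using finU QI subpartitions_subset_Pow[of U "{?S}"] by (intro card_mono) auto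
  ultimately show ?thesis by blast
qed

lemma rank_decomposableE:
  assumes "rank_decomposable R d n \<R> T k"
  obtains P a where "\<And>i. i < k \<Longrightarrow> P i \<in> \<R>"
    "\<And>i J. i < k \<Longrightarrow> J \<in> P i \<Longrightarrow> a i J \<in> box n J \<rightarrow> carrier R"
    "\<And>x. x \<in> box n {1..d} \<Longrightarrow> T x = (\<Oplus>i\<in>{..<k}. \<Otimes>J\<in>P i. a i J (restrict x J))"
proof -
  obtain Ts where Ts: "\<forall>i<k. tensor R d n (Ts i) \<and> R_rank_le_one R d n \<R> (Ts i)"
    and T: "\<forall>x\<in>box n {1..d}. T x = (\<Oplus>i\<in>{..<k}. Ts i x)"
    using assms unfolding rank_decomposable_def by blast
  define factors where "factors i P a \<longleftrightarrow> P \<in> \<R> \<and> (\<forall>J\<in>P. a J \<in> box n J \<rightarrow> carrier R) \<and>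
     (\<forall>x\<in>box n {1..d}. Ts i x = (\<Otimes>J\<in>P. a J (restrict x J)))" for i P a
  have "\<exists>P a. factors i P a" if "i < k" for i
    using Ts that unfolding factors_def R_rank_le_one_def by blast
  then obtain P a where Pa: "\<And>i. i < k \<Longrightarrow> factors i (P i) (a i)" by metis
  note Pa' = Pa[unfolded factors_def]
  show ?thesis
  proof (rule that)
    show "P i \<in> \<R>" if "i < k" for i using Pa'[OF that] by blast
    show "a i J \<in> box n J \<rightarrow> carrier R" if "i < k" "J \<in> P i" for i J
      using Pa'[OF that(1)] that(2) by blast
    fix x assume x: "x \<in> box n {1..d}"
    have "Ts i x \<in> carrier R" if "i < k" for i using Ts that x unfolding tensor_def by blast
    moreover have "Ts i x = (\<Otimes>J\<in>P i. a i J (restrict x J))" if "i < k" for i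
      using Pa'[OF that] x by blast
    ultimately have "(\<Oplus>i\<in>{..<k}. Ts i x) = (\<Oplus>i\<in>{..<k}. \<Otimes>J\<in>P i. a i J (restrict x J))"
      by (intro finsum_cong') auto
    then show "T x = (\<Oplus>i\<in>{..<k}. \<Otimes>J\<in>P i. a i J (restrict x J))" using T x by simp
  qed
qed

lemma rank_decomposableI:
  fixes k :: nat
  assumes \<R>: "partition_family d \<R>" and "\<And>i. i < k \<Longrightarrow> P i \<in> \<R>"
    and "\<And>i J. i < k \<Longrightarrow> J \<in> P i \<Longrightarrow> a i J \<in> box n J \<rightarrow> carrier R"
    and "\<And>x. x \<in> box n {1..d} \<Longrightarrow> T x = (\<Oplus>i\<in>{..<k}. \<Otimes>J\<in>P i. a i J (restrict x J))"
  shows "rank_decomposable R d n \<R> T k"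
proof -
  have "R_rank_le_one R d n \<R> (\<lambda>x. \<Otimes>J\<in>P i. a i J (restrict x J))" if i: "i < k" for i
    unfolding R_rank_le_one_def using assms(3)[OF i]
    by (intro bexI[OF _ assms(2)[OF i]] exI[of _ "a i"]) simp
  then show ?thesis unfolding rank_decomposable_def using R_rank_le_one_closed[OF \<R>] assms(4)
    by (intro exI[of _ "\<lambda>i x. \<Otimes>J\<in>P i. a i J (restrict x J)"]) blast
qed

text \<open>Every non-empty set of coordinates is given \<open>k1 + k2\<close> indices in advance,
  enough for one index per term of both decompositions. The starting labels depend on
  \<open>d\<close>, \<open>k1\<close> and \<open>k2\<close> alone, so \<open>b\<close> can be chosen
  from these.\<close>

lemma R_rank_refine_le:
  assumes R1: "partition_family d R1" and R2: "partition_family d R2" and d: "d \<ge> 1"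
    and T: "tensor R d n T" and k: "R_rank R d n R1 T \<le> k1" "R_rank R d n R2 T \<le> k2"
    and b: "expansion_bound ((Pow {1..d} - {{}}) \<times> {..<k1 + k2}) b"
  shows "R_rank R d n (refine_family R1 R2) T \<le> b"
proof -
  define r1 where "r1 = R_rank R d n R1 T"
  define r2 where "r2 = R_rank R d n R2 T"
  obtain P1 a1 where P1: "\<And>i. i < r1 \<Longrightarrow> P1 i \<in> R1"
    and a1: "\<And>i J. i < r1 \<Longrightarrow> J \<in> P1 i \<Longrightarrow> a1 i J \<in> box n J \<rightarrow> carrier R"
    and T1: "\<And>x. x \<in> box n {1..d} \<Longrightarrow> T x = (\<Oplus>i\<in>{..<r1}. \<Otimes>J\<in>P1 i. a1 i J (restrict x J))"
    using rank_decomposable_R_rank[OF R1 d T, folded r1_def] by (rule rank_decomposableE) (rule that)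
  obtain P2 a2 where P2: "\<And>i. i < r2 \<Longrightarrow> P2 i \<in> R2"
    and a2: "\<And>i J. i < r2 \<Longrightarrow> J \<in> P2 i \<Longrightarrow> a2 i J \<in> box n J \<rightarrow> carrier R"
    and T2: "\<And>x. x \<in> box n {1..d} \<Longrightarrow> T x = (\<Oplus>i\<in>{..<r2}. \<Otimes>J\<in>P2 i. a2 i J (restrict x J))"
    using rank_decomposable_R_rank[OF R2 d T, folded r2_def] by (rule rank_decomposableE) (rule that)
  let ?U = "(Pow {1..d} - {{}}) \<times> {..<k1 + k2}"
  \<comment> \<open>Terms of the second decomposition are shifted by \<open>r1\<close> to keep them
    apart from those of the first; the remaining labels carry the zero function.\<close>
  define g where "g p = (if snd p < r1 \<and> fst p \<in> P1 (snd p) then a1 (snd p) (fst p)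
    else if r1 \<le> snd p \<and> snd p - r1 < r2 \<and> fst p \<in> P2 (snd p - r1) then a2 (snd p - r1) (fst p)
    else (\<lambda>_. \<zero>))" for p
  have ts: "tsystem n ?U g"
    unfolding tsystem_def
  proof (intro conjI ballI)
    fix p assume p: "p \<in> ?U"
    show "fst p \<noteq> {}" "finite (fst p)" using p finite_subset[of "fst p" "{1..d}"] by auto
    show "g p \<in> box n (fst p) \<rightarrow> carrier R" unfolding g_def using a1 a2 by simp
  qed simp
  obtain U' g' where ts': "tsystem n U' g'" and reg: "regular n U' g' (card (Pow U'))"
    and card: "card (Pow U') \<le> b"
    and sp: "\<forall>p\<in>?U. lspan n g' (subpartitions U' {fst p}) (fst p) (g p)"
    using regularise[OF b ts] by blast
  have lab: "(J, i) \<in> ?U" if "J \<in> P" "P \<in> R1 \<union> R2" "i < k1 + k2" for J P i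
    using R1 R2 that unfolding partition_family_def partition_on_def by blast
  have "lspan n g' (\<Union>P\<in>R1. subpartitions U' P) {1..d} T"
  proof (rule lspan_rank_sum[where P = P1 and a = a1 and k = r1, OF ts' R1 P1 _ T1])
    fix i J assume i: "i < r1" "J \<in> P1 i"
    have "(J, i) \<in> ?U" using lab[OF i(2), of i] P1[OF i(1)] i(1) k(1) unfolding r1_def by auto
    from bspec[OF sp this] show "lspan n g' (subpartitions U' {J}) J (a1 i J)"
      unfolding g_def using i by simp
  qed
  moreover have "lspan n g' (\<Union>P\<in>R2. subpartitions U' P) {1..d} T"
  proof (rule lspan_rank_sum[where P = P2 and a = a2 and k = r2, OF ts' R2 P2 _ T2])
    fix i J assume i: "i < r2" "J \<in> P2 i"
    have "(J, r1 + i) \<in> ?U"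
      using lab[OF i(2), of "r1 + i"] P2[OF i(1)] i(1) k unfolding r1_def r2_def by auto
    from bspec[OF sp this] show "lspan n g' (subpartitions U' {J}) J (a2 i J)"
      unfolding g_def using i by simp
  qed
  ultimately obtain k where "k \<le> card (Pow U')" "rank_decomposable R d n (refine_family R1 R2) T k"
    using rank_decomposable_refine[OF ts' reg R1 R2 d] by blast
  then show ?thesis using R_rank_le card by (meson order_trans)
qed

end

section \<open>Passing to a countable field\<close>

lemma hom_sum_of_products:
  fixes k :: nat
  assumes "field K" "field F" "h \<in> ring_hom K F"
    and a: "\<And>i J. i < k \<Longrightarrow> J \<in> P i \<Longrightarrow> b i J \<in> carrier K"
  shows "h (\<Oplus>\<^bsub>K\<^esub>i\<in>{..<k}. \<Otimes>\<^bsub>K\<^esub>J\<in>P i. b i J) = (\<Oplus>\<^bsub>F\<^esub>i\<in>{..<k}. \<Otimes>\<^bsub>F\<^esub>J\<in>P i. h (b i J))"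
proof -
  interpret K: field K by fact
  interpret F: field F by fact
  interpret ring_hom_cring K F h using assms(3) by unfold_locales
  have c: "(\<Otimes>\<^bsub>K\<^esub>J\<in>P i. b i J) \<in> carrier K" if "i < k" for i
    using a[OF that] by (intro K.finprod_closed) auto
  have "h (\<Oplus>\<^bsub>K\<^esub>i\<in>{..<k}. \<Otimes>\<^bsub>K\<^esub>J\<in>P i. b i J) = (\<Oplus>\<^bsub>F\<^esub>i\<in>{..<k}. (h \<circ> (\<lambda>i. \<Otimes>\<^bsub>K\<^esub>J\<in>P i. b i J)) i)"
    by (rule hom_finsum) (use c in auto)
  also have "\<dots> = (\<Oplus>\<^bsub>F\<^esub>i\<in>{..<k}. \<Otimes>\<^bsub>F\<^esub>J\<in>P i. h (b i J))"
  proof (rule F.finsum_cong')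
    fix i assume i: "i \<in> {..<k}"
    have "h (\<Otimes>\<^bsub>K\<^esub>J\<in>P i. b i J) = (\<Otimes>\<^bsub>F\<^esub>J\<in>P i. (h \<circ> b i) J)"
      by (rule hom_finprod) (use a i in auto)
    then show "(h \<circ> (\<lambda>i. \<Otimes>\<^bsub>K\<^esub>J\<in>P i. b i J)) i = (\<Otimes>\<^bsub>F\<^esub>J\<in>P i. h (b i J))" by (simp add: comp_def)
  next
    show "(\<lambda>i. \<Otimes>\<^bsub>F\<^esub>J\<in>P i. h (b i J)) \<in> {..<k} \<rightarrow> carrier F"
      using a by (intro Pi_I F.finprod_closed) auto
  qed simp
  finally show ?thesis .
qed

lemma restrict_part_in_box:
  "partition_family d \<R> \<Longrightarrow> P \<in> \<R> \<Longrightarrow> J \<in> P \<Longrightarrow> x \<in> box n {1..d} \<Longrightarrow> restrict x J \<in> box n J"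
  unfolding partition_family_def partition_on_def by (rule restrict_in_box) auto

text \<open>A homomorphism commutes with the sums and products, so it can be applied to each factor.
  This carries decompositions to an isomorphic copy of a field and from a subfield to the whole
  field.\<close>

lemma rank_decomposable_hom:
  assumes K: "field K" and F: "field F" and h: "h \<in> ring_hom K F" and \<R>: "partition_family d \<R>"
    and D: "rank_decomposable K d n \<R> T k"
  shows "rank_decomposable F d n \<R> (\<lambda>x. h (T x)) k"
proof -
  obtain P a where P: "\<And>i. i < k \<Longrightarrow> P i \<in> \<R>"
    and a: "\<And>i J. i < k \<Longrightarrow> J \<in> P i \<Longrightarrow> a i J \<in> box n J \<rightarrow> carrier K"
    and T: "\<And>x. x \<in> box n {1..d} \<Longrightarrow> T x = (\<Oplus>\<^bsub>K\<^esub>i\<in>{..<k}. \<Otimes>\<^bsub>K\<^esub>J\<in>P i. a i J (restrict x J))"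
    by (rule field.rank_decomposableE[OF K D]) (rule that)
  show ?thesis
  proof (rule field.rank_decomposableI[where P = P and a = "\<lambda>i J z. h (a i J z)" and k = k, OF F \<R> P])
    show "(\<lambda>z. h (a i J z)) \<in> box n J \<rightarrow> carrier F" if "i < k" "J \<in> P i" for i J
      using a[OF that] ring_hom_closed[OF h] by blast
    fix x assume x: "x \<in> box n {1..d}"
    show "h (T x) = (\<Oplus>\<^bsub>F\<^esub>i\<in>{..<k}. \<Otimes>\<^bsub>F\<^esub>J\<in>P i. h (a i J (restrict x J)))"
      unfolding T[OF x]
    proof (rule hom_sum_of_products[OF K F h])
      show "a i J (restrict x J) \<in> carrier K" if "i < k" "J \<in> P i" for i J
        using funcset_mem[OF a[OF that] restrict_part_in_box[OF \<R> P[OF that(1)] that(2) x]] .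
    qed
  qed
qed

section \<open>Countable subfields\<close>

datatype field_expr = One | Gen nat | Neg field_expr | Inv field_expr
  | Add field_expr field_expr | Mul field_expr field_expr

instance field_expr :: countable by countable_datatype

primrec field_expr_value :: "('a, 'm) ring_scheme \<Rightarrow> (nat \<Rightarrow> 'a) \<Rightarrow> field_expr \<Rightarrow> 'a" where
  "field_expr_value F s One = \<one>\<^bsub>F\<^esub>"
| "field_expr_value F s (Gen i) = s i"
| "field_expr_value F s (Neg e) = \<ominus>\<^bsub>F\<^esub> field_expr_value F s e"
| "field_expr_value F s (Inv e) = inv\<^bsub>F\<^esub> field_expr_value F s e"
| "field_expr_value F s (Add e f) = field_expr_value F s e \<oplus>\<^bsub>F\<^esub> field_expr_value F s f"
| "field_expr_value F s (Mul e f) = field_expr_value F s e \<otimes>\<^bsub>F\<^esub> field_expr_value F s f"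

text \<open>Each element of the generated field is the value of a term in the field operations over
  an enumeration of \<open>H\<close>, and there are countably many terms. An inclusion in the range
  suffices, so the arbitrary values of \<open>from_nat_into\<close> for empty \<open>H\<close> do no
  harm.\<close>

lemma countable_generate_field:
  assumes "countable H"
  shows "countable (generate_field F H)"
proof -
  let ?v = "field_expr_value F (from_nat_into H)"
  have "x \<in> range ?v" if "x \<in> generate_field F H" for x
    using that
  proof induction
    case one
    show ?case by (rule range_eqI[of _ _ One]) simp
  next
    case (incl h)
    then obtain i where "h = from_nat_into H i" using from_nat_into_surj[OF assms] by metis
    then show ?case by (intro range_eqI[of _ _ "Gen i"]) simp
  next
    case (a_inv h)
    then obtain e where "h = ?v e" by blast
    then show ?case by (intro range_eqI[of _ _ "Neg e"]) simp
  next
    case (m_inv h)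
    then obtain e where "h = ?v e" by blast
    then show ?case by (intro range_eqI[of _ _ "Inv e"]) simp
  next
    case (eng_add h1 h2)
    then obtain e1 e2 where "h1 = ?v e1" "h2 = ?v e2" by blast
    then show ?case by (intro range_eqI[of _ _ "Add e1 e2"]) simp
  next
    case (eng_mult h1 h2)
    then obtain e1 e2 where "h1 = ?v e1" "h2 = ?v e2" by blast
    then show ?case by (intro range_eqI[of _ _ "Mul e1 e2"]) simp
  qed
  then have "generate_field F H \<subseteq> range ?v" by (rule subsetI)
  then show ?thesis by (rule countable_subset) simp
qed

text \<open>\<open>H\<close> collects the finitely many values of all factors. Over a subfield
  containing \<open>H\<close> the same factors still work, since the inclusion is a homomorphism and
  so sums and products there agree with those in \<open>F\<close>.\<close>

lemma rank_decomposable_countable_subfield: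
  assumes F: "field F" and \<R>: "partition_family d \<R>" and D: "rank_decomposable F d n \<R> T k"
  obtains H where "countable H" "H \<subseteq> carrier F"
    "\<And>K. field (F\<lparr>carrier := K\<rparr>) \<Longrightarrow> H \<subseteq> K \<Longrightarrow> K \<subseteq> carrier F \<Longrightarrow>
       rank_decomposable (F\<lparr>carrier := K\<rparr>) d n \<R> T k"
proof -
  obtain P a where P: "\<And>i. i < k \<Longrightarrow> P i \<in> \<R>"
    and a: "\<And>i J. i < k \<Longrightarrow> J \<in> P i \<Longrightarrow> a i J \<in> box n J \<rightarrow> carrier F"
    and T: "\<And>x. x \<in> box n {1..d} \<Longrightarrow> T x = (\<Oplus>\<^bsub>F\<^esub>i\<in>{..<k}. \<Otimes>\<^bsub>F\<^esub>J\<in>P i. a i J (restrict x J))"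
    by (rule field.rank_decomposableE[OF F D]) (rule that)
  define H where "H = (\<Union>i\<in>{..<k}. \<Union>J\<in>P i. a i J ` box n J)"
  have part: "partition_on {1..d} (P i)" if "i < k" for i
    using \<R> P[OF that] unfolding partition_family_def by blast
  have "finite (P i)" "\<forall>J\<in>P i. finite J" if "i < k" for i
    using finite_elements[OF _ part[OF that]] part[OF that] finite_subset[of _ "{1..d}"]
    unfolding partition_on_def by auto
  then have "finite H" unfolding H_def by (auto intro!: finite_box)
  show ?thesis
  proof (rule that)
    show "countable H" using \<open>finite H\<close> by (rule countable_finite)
    show "H \<subseteq> carrier F" unfolding H_def using a by blast
    fix K assume K: "field (F\<lparr>carrier := K\<rparr>)" "H \<subseteq> K" "K \<subseteq> carrier F"
    have id: "id \<in> ring_hom (F\<lparr>carrier := K\<rparr>) F"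
      using K(3) by (auto intro!: ring_hom_memI)
    show "rank_decomposable (F\<lparr>carrier := K\<rparr>) d n \<R> T k"
    proof (rule field.rank_decomposableI[where P = P and a = a and k = k, OF K(1) \<R> P])
      show aK: "a i J \<in> box n J \<rightarrow> carrier (F\<lparr>carrier := K\<rparr>)" if "i < k" "J \<in> P i" for i J
        using that K(2) unfolding H_def by auto
      fix x assume x: "x \<in> box n {1..d}"
      have "id (\<Oplus>\<^bsub>F\<lparr>carrier := K\<rparr>\<^esub>i\<in>{..<k}. \<Otimes>\<^bsub>F\<lparr>carrier := K\<rparr>\<^esub>J\<in>P i. a i J (restrict x J)) =
          (\<Oplus>\<^bsub>F\<^esub>i\<in>{..<k}. \<Otimes>\<^bsub>F\<^esub>J\<in>P i. id (a i J (restrict x J)))"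
      proof (rule hom_sum_of_products[OF K(1) F id])
        show "a i J (restrict x J) \<in> carrier (F\<lparr>carrier := K\<rparr>)" if "i < k" "J \<in> P i" for i J
          using funcset_mem[OF aK[OF that] restrict_part_in_box[OF \<R> P[OF that(1)] that(2) x]] .
      qed
      then show "T x = (\<Oplus>\<^bsub>F\<lparr>carrier := K\<rparr>\<^esub>i\<in>{..<k}. \<Otimes>\<^bsub>F\<lparr>carrier := K\<rparr>\<^esub>J\<in>P i. a i J (restrict x J))"
        using T[OF x] by simp
    qed
  qed
qed

lemma rank_decomposable_tensor:
  assumes F: "field F" and \<R>: "partition_family d \<R>" and D: "rank_decomposable F d n \<R> T k"
  shows "tensor F d n T"
proof -
  interpret field F by fact
  obtain Ts where Ts: "\<forall>i<k. tensor F d n (Ts i)" "\<forall>x\<in>box n {1..d}. T x = (\<Oplus>\<^bsub>F\<^esub>i\<in>{..<k}. Ts i x)"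
    using D unfolding rank_decomposable_def by blast
  have "T x \<in> carrier F" if x: "x \<in> box n {1..d}" for x
    using Ts x unfolding tensor_def by (auto intro!: finsum_closed)
  then show ?thesis unfolding tensor_def by blast
qed

section \<open>Transfer of the bound to arbitrary fields\<close>

lemma R_rank_refine_le_refinement_bound:
  fixes F :: "nat ring"
  assumes "partition_family d R1" "partition_family d R2" "d \<ge> 1"
    "field F" "\<forall>i\<in>{1..d}. n i \<ge> 1" "tensor F d n T" "R_rank F d n R1 T \<le> k1" "R_rank F d n R2 T \<le> k2"
  shows "R_rank F d n (refine_family R1 R2) T \<le> refinement_bound d R1 R2 k1 k2"
proof -
  let ?U = "(Pow {1..d} - {{}}) \<times> {..<k1 + k2}"
  let ?bound = "\<lambda>C. \<forall>(F :: nat ring) n T. field F \<longrightarrow> (\<forall>i\<in>{1..d}. n i \<ge> 1) \<longrightarrow> tensor F d n T \<longrightarrow>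
        R_rank F d n R1 T \<le> k1 \<longrightarrow> R_rank F d n R2 T \<le> k2 \<longrightarrow>
        R_rank F d n (refine_family R1 R2) T \<le> C"
  have "finite (fst p)" if "p \<in> ?U" for p using that finite_subset[of "fst p" "{1..d}"] by auto
  then obtain b where "expansion_bound ?U b" using expansion_bound_exists[of ?U] by auto
  \<comment> \<open>One \<open>b\<close> works for all fields at once, since
    \<open>expansion_bound\<close> mentions labels only; so there is a number satisfying the
    condition under \<open>LEAST\<close>.\<close>
  then have "?bound b" using field.R_rank_refine_le[OF _ assms(1-3)] by blast
  then have "?bound (refinement_bound d R1 R2 k1 k2)"
    unfolding refinement_bound_def by (rule LeastI)
  then show ?thesis using assms(4-8) by blast
qed

theorem theorem1p9:
  fixes F :: "('a, 'm) ring_scheme" and d k1 k2 :: nat and R1 R2 :: "nat set set set"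
    and n :: "nat \<Rightarrow> nat" and T :: "(nat \<Rightarrow> nat) \<Rightarrow> 'a"
  assumes "d \<ge> 2" and "k1 \<ge> 1" and "k2 \<ge> 1"
    and "partition_family d R1" and "partition_family d R2"
    and "field F" and "\<forall>i\<in>{1..d}. n i \<ge> 1" and "tensor F d n T"
    and "R_rank F d n R1 T \<le> k1" and "R_rank F d n R2 T \<le> k2"
  shows "R_rank F d n (refine_family R1 R2) T \<le> refinement_bound d R1 R2 k1 k2"
proof -
  interpret field F by fact
  note R1 = assms(4) and R2 = assms(5)
  note R12 = partition_family_refine[OF R1 R2]
  have d: "d \<ge> 1" using assms(1) by simp
  obtain H1 where H1: "countable H1" "H1 \<subseteq> carrier F" and D1: "\<And>K. field (F\<lparr>carrier := K\<rparr>) \<Longrightarrow> H1 \<subseteq> K \<Longrightarrow>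
      K \<subseteq> carrier F \<Longrightarrow> rank_decomposable (F\<lparr>carrier := K\<rparr>) d n R1 T (R_rank F d n R1 T)"
    by (rule rank_decomposable_countable_subfield
        [OF assms(6) R1 rank_decomposable_R_rank[OF R1 d assms(8)]]) (rule that)
  obtain H2 where H2: "countable H2" "H2 \<subseteq> carrier F" and D2: "\<And>K. field (F\<lparr>carrier := K\<rparr>) \<Longrightarrow> H2 \<subseteq> K \<Longrightarrow>
      K \<subseteq> carrier F \<Longrightarrow> rank_decomposable (F\<lparr>carrier := K\<rparr>) d n R2 T (R_rank F d n R2 T)"
    by (rule rank_decomposable_countable_subfield
        [OF assms(6) R2 rank_decomposable_R_rank[OF R2 d assms(8)]]) (rule that)
  \<comment> \<open>One subfield for both decompositions, countable because its generators
    are.\<close>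
  define K where "K = generate_field F (H1 \<union> H2)"
  have K: "K \<subseteq> carrier F" "H1 \<subseteq> K" "H2 \<subseteq> K" "countable K"
    unfolding K_def using generate_field_incl[of "H1 \<union> H2"] H1 H2
      countable_generate_field[of "H1 \<union> H2" F] by (auto intro: generate_field.incl)
  define E where "E = F\<lparr>carrier := K\<rparr>"
  have E: "field E" and cE: "carrier E = K"
    unfolding E_def K_def using generate_field_is_field H1(2) H2(2) by auto
  have D1E: "rank_decomposable E d n R1 T (R_rank F d n R1 T)"
    unfolding E_def by (rule D1[OF E[unfolded E_def] K(2,1)])
  have D2E: "rank_decomposable E d n R2 T (R_rank F d n R2 T)"
    unfolding E_def by (rule D2[OF E[unfolded E_def] K(3,1)])
  \<comment> \<open>The countable subfield is copied onto a set of natural numbers, where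
    \<open>refinement_bound\<close> applies.\<close>
  define h where "h = to_nat_on K"
  define N where "N = image_ring h E"
  have inj: "inj_on h (carrier E)" unfolding h_def cE using K(4) by (rule inj_on_to_nat_on)
  have N: "field N" unfolding N_def using field.inj_imp_image_ring_is_field[OF E inj] .
  have iso: "h \<in> ring_iso E N" unfolding N_def by (rule inj_imp_image_ring_iso[OF inj])
  then have hom: "h \<in> ring_hom E N" unfolding ring_iso_def by blast
  interpret E: field E by (rule E)
  have "inv_into (carrier E) h \<in> ring_iso N E" using E.ring_axioms iso by (rule ring_iso_set_sym)
  then have "inv_into (carrier E) h \<in> ring_hom N E" unfolding ring_iso_def by blast
  moreover have "id \<in> ring_hom E F" unfolding E_def using K(1) by (auto intro!: ring_hom_memI)
  \<comment> \<open>The way back to \<open>F\<close>: undo the copy, then include the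
    subfield.\<close>
  ultimately have hom': "id \<circ> inv_into (carrier E) h \<in> ring_hom N F" by (rule ring_hom_trans)
  define T' where "T' x = h (T x)" for x
  \<comment> \<open>The transported decompositions keep the lengths given by the ranks over
    \<open>F\<close>, so the ranks over \<open>N\<close> cannot be larger.\<close>
  have D1N: "rank_decomposable N d n R1 T' (R_rank F d n R1 T)"
    unfolding T'_def by (rule rank_decomposable_hom[OF E N hom R1 D1E])
  have D2N: "rank_decomposable N d n R2 T' (R_rank F d n R2 T)"
    unfolding T'_def by (rule rank_decomposable_hom[OF E N hom R2 D2E])
  have T': "tensor N d n T'" using rank_decomposable_tensor[OF N R1 D1N] .
  have "R_rank N d n R1 T' \<le> k1" "R_rank N d n R2 T' \<le> k2"
    using R_rank_le[OF D1N] R_rank_le[OF D2N] assms(9,10) by auto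
  then have bound: "R_rank N d n (refine_family R1 R2) T' \<le> refinement_bound d R1 R2 k1 k2"
    using R_rank_refine_le_refinement_bound[OF R1 R2 d N assms(7) T'] by blast
  have "rank_decomposable F d n (refine_family R1 R2) (\<lambda>x. (id \<circ> inv_into (carrier E) h) (T' x))
      (R_rank N d n (refine_family R1 R2) T')"
    by (rule rank_decomposable_hom[OF N assms(6) hom' R12 field.rank_decomposable_R_rank[OF N R12 d T']])
  \<comment> \<open>The round trip fixes values in the subfield, and \<open>T\<close> takes only
    such values on the box.\<close>
  moreover have "(id \<circ> inv_into (carrier E) h) (T' x) = T x" if "x \<in> box n {1..d}" for x
  proof -
    have "T x \<in> carrier E" using rank_decomposable_tensor[OF E R1 D1E] that unfolding tensor_def by blast
    then show ?thesis unfolding T'_def using inv_into_f_f[OF inj] by simp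
  qed
  ultimately have "rank_decomposable F d n (refine_family R1 R2) T (R_rank N d n (refine_family R1 R2) T')"
    unfolding rank_decomposable_def by simp
  then show ?thesis using R_rank_le bound by (meson order_trans)
qed

end
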